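(* Suppose that $q$ is continuous. Let $y^{(n)}$ be the iterates of the following algorithm with input $(a,b,N)$. For each $n\le N$: set $c\leftarrow(a+b)/2$; compute $Z^{c,c}$, the solution of the Cauchy problem $\dot Y_t=\Phi(t,Y_t,c)$, $Y_0=c$; set $y^{(n)}\leftarrow Z^{c,c}$; if $t\mapsto y^{(n)}(t)$ does not diverge to $+\infty$ as $t\to+\infty$, set $a\leftarrow c$; else set $b\leftarrow c$. Then $$\left\|V^\star(0)-y^{(n)}(0)\right\|=O(1/2^n).$$
   Context: Setting. Auctions arrive according to a Poisson process of intensity $\mu$. At the $i$-th auction the price to beat is $C_i\ge0$; the $C_i$ are i.i.d. with cumulative distribution function $q$, and $q(b)$ is the probability of winning with bid $b$. The age $\tau$ is the time elapsed since the last won auction: it grows at unit rate and is reset to $0$ after each win. An item won at age $\tau$ has value $k(\tau)$ for the bidder, where $k$ is a non-decreasing bounded function; write $k_t=k(t)$. A bidding policy is a measurable function $b:\tau\mapsto b(\tau)\in\mathbb{R}^+$, the bid submitted when the age is $\tau$; $\mathcal{B}$ is the set of such policies. The auctions are second price: the winner pays $C_i$. With discount rate $\gamma$, current age $\tau$, next auctions at times $T_1<T_2<\dots$ (measured from now), and $\tau(T_i)$ the age at the auction at time $T_i$ under policy $b$, set $$V_b(\tau)=\mathbb{E}\sum_{i\ge1}e^{-\gamma T_i}\left(k(\tau(T_i))-C_i\right)\mathbf{1}\{b(\tau(T_i))>C_i\},\qquad V^\star(\tau)=\sup_{b\in\mathcal{B}}V_b(\tau).$$ Let $\pi(v)=\int_0^v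 q(t)\,dt$ and let $\Phi:\mathbb{R}\times\mathbb{R}_+\times\mathbb{R}_+\to\mathbb{R}$ be $\Phi(t,y,\lambda)=\gamma y-\mu\,\pi(k_t+\lambda-y)$. For $y_0>0$ and $\lambda>0$, $Z^{y_0,\lambda}$ denotes the unique maximal solution of the Cauchy problem $\dot Y_t=\Phi(t,Y_t,\lambda)$, $Y_0=y_0$. In the algorithm, $a$ and $b$ are the numbers given as input (endpoints of the search interval; here $b$ is not a bidding policy) and $N$ is the number of iterations.
   Formalization: The input interval is assumed to satisfy 0 ≤ a, b > 0 and a ≤ V*(0) ≤ b; if V*(0) lies outside [a,b] the bisection converges to an endpoint and the claim fails, and for c ≤ 0 the solution Z^{c,c} is not defined. *)

theory Defs
  imports "HOL-Probability.Probability" "HOL-Library.Landau_Symbols"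
begin

section \<open>The auction model\<close>

text \<open>
  Auctions and iterations are numbered from \<open>0\<close>. The Poisson process of arrivals is given by
  its inter-arrival times \<open>X i\<close>, which are independent and exponentially distributed; \<open>C i\<close> is the
  price to beat at auction \<open>i\<close>. All the \<open>X i\<close> and \<open>C i\<close> together form one independent family. Only the
  values of \<open>k\<close> on non-negative ages are meaningful.
\<close>

locale auction_model = prob_space M
  for M :: "'a measure"
    and X C :: "nat \<Rightarrow> 'a \<Rightarrow> real"
    and q k :: "real \<Rightarrow> real"
    and \<mu> \<gamma> :: real +
  assumes intensity_pos: "\<mu> > 0"
    and discount_pos: "\<gamma> > 0"
    and interarrival: "\<And>i. distributed M lborel (X i) (exponential_density \<mu>)"
    and price_cdf: "\<And>i x. cdf (distr M borel (C i)) x = q x"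
    and price_nonneg: "\<And>i. AE \<omega> in M. C i \<omega> \<ge> 0"
    and indep: "indep_vars (\<lambda>_. borel) (case_sum X C) UNIV"
    and value_mono: "mono_on {0..} k"
    and value_bounded: "bounded (k ` {0..})"

definition arrival :: "(nat \<Rightarrow> 'a \<Rightarrow> real) \<Rightarrow> nat \<Rightarrow> 'a \<Rightarrow> real" where
  "arrival X i \<omega> = (\<Sum>j\<le>i. X j \<omega>)"

text \<open>The age just before the outcome of auction \<open>i\<close>, for the bidding policy \<open>\<beta>\<close> and initial age \<open>\<tau>\<close>.\<close>

primrec age ::
  "(nat \<Rightarrow> 'a \<Rightarrow> real) \<Rightarrow> (nat \<Rightarrow> 'a \<Rightarrow> real) \<Rightarrow> (real \<Rightarrow> real) \<Rightarrow> real \<Rightarrow> nat \<Rightarrow> 'a \<Rightarrow> real" where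
  "age X C \<beta> \<tau> 0 \<omega> = \<tau> + X 0 \<omega>"
| "age X C \<beta> \<tau> (Suc i) \<omega> =
     (if \<beta> (age X C \<beta> \<tau> i \<omega>) > C i \<omega> then 0 else age X C \<beta> \<tau> i \<omega>) + X (Suc i) \<omega>"

definition policies :: "(real \<Rightarrow> real) set" where
  "policies = {\<beta>. \<beta> \<in> borel_measurable borel \<and> (\<forall>t. \<beta> t \<ge> 0)}"

definition payoff ::
  "(nat \<Rightarrow> 'a \<Rightarrow> real) \<Rightarrow> (nat \<Rightarrow> 'a \<Rightarrow> real) \<Rightarrow> (real \<Rightarrow> real) \<Rightarrow> real \<Rightarrow>
     (real \<Rightarrow> real) \<Rightarrow> real \<Rightarrow> nat \<Rightarrow> 'a \<Rightarrow> real" where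
  "payoff X C k \<gamma> \<beta> \<tau> i \<omega> =
     exp (- \<gamma> * arrival X i \<omega>) * (k (age X C \<beta> \<tau> i \<omega>) - C i \<omega>) *
     of_bool (\<beta> (age X C \<beta> \<tau> i \<omega>) > C i \<omega>)"

text \<open>
  The prices need not be integrable and the bids need not be bounded, so the expected discounted
  payoff may be \<open>-\<infinity>\<close>. Its positive part always has finite expectation because \<open>k\<close> is bounded and
  the prices are non-negative, so the expectation of the series is well-defined in the extended reals
  as the expectation of the positive terms minus that of the negative ones. Note that
  \<^const>\<open>ennreal\<close> maps negative numbers to \<open>0\<close>.
\<close>

definition policy_value ::
  "'a measure \<Rightarrow> (nat \<Rightarrow> 'a \<Rightarrow> real) \<Rightarrow> (nat \<Rightarrow> 'a \<Rightarrow> real) \<Rightarrow> (real \<Rightarrow> real) \<Rightarrow> real \<Rightarrow>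
     (real \<Rightarrow> real) \<Rightarrow> real \<Rightarrow> ereal" where
  "policy_value M X C k \<gamma> \<beta> \<tau> =
     enn2ereal (\<integral>\<^sup>+\<omega>. (\<Sum>i. ennreal (payoff X C k \<gamma> \<beta> \<tau> i \<omega>)) \<partial>M) -
     enn2ereal (\<integral>\<^sup>+\<omega>. (\<Sum>i. ennreal (- payoff X C k \<gamma> \<beta> \<tau> i \<omega>)) \<partial>M)"

definition optimal_value ::
  "'a measure \<Rightarrow> (nat \<Rightarrow> 'a \<Rightarrow> real) \<Rightarrow> (nat \<Rightarrow> 'a \<Rightarrow> real) \<Rightarrow> (real \<Rightarrow> real) \<Rightarrow> real \<Rightarrow>
     real \<Rightarrow> ereal" where
  "optimal_value M X C k \<gamma> \<tau> = (SUP \<beta>\<in>policies. policy_value M X C k \<gamma> \<beta> \<tau>)"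


section \<open>The Cauchy problem\<close>

definition price_primitive :: "(real \<Rightarrow> real) \<Rightarrow> real \<Rightarrow> real" where
  "price_primitive q v = (LBINT t=ereal 0..ereal v. q t)"

definition Phi ::
  "(real \<Rightarrow> real) \<Rightarrow> (real \<Rightarrow> real) \<Rightarrow> real \<Rightarrow> real \<Rightarrow> real \<Rightarrow> real \<Rightarrow> real \<Rightarrow> real" where
  "Phi q k \<mu> \<gamma> t y l = \<gamma> * y - \<mu> * price_primitive q (k t + l - y)"

text \<open>
  \<open>Y\<close> solves \<open>Y' = F t Y\<close>, \<open>Y 0 = y0\<close> forward in time on the interval \<open>J\<close>, with values in the domain
  \<open>[0,\<infinity>)\<close> of the second argument of \<^const>\<open>Phi\<close>. Since a non-decreasing \<open>k\<close> may have (countably many)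
  jumps, the solution is continuous and the equation may fail on a countable set of times. Values of
  \<open>Y\<close> outside \<open>J\<close> are fixed by \<^const>\<open>extensional\<close>, so that a solution is determined as a pair \<open>(J, Y)\<close>.
\<close>

definition solves_cauchy ::
  "(real \<Rightarrow> real \<Rightarrow> real) \<Rightarrow> real \<Rightarrow> real set \<Rightarrow> (real \<Rightarrow> real) \<Rightarrow> bool" where
  "solves_cauchy F y0 J Y \<longleftrightarrow>
     is_interval J \<and> 0 \<in> J \<and> J \<subseteq> {0..} \<and>
     Y \<in> extensional J \<and> (\<forall>t\<in>J. Y t \<ge> 0) \<and> Y 0 = y0 \<and> continuous_on J Y \<and>
     (\<exists>S. countable S \<and> (\<forall>t\<in>J - S. (Y has_real_derivative F t (Y t)) (at t within J)))"

definition maximal_solution ::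
  "(real \<Rightarrow> real \<Rightarrow> real) \<Rightarrow> real \<Rightarrow> real set \<Rightarrow> (real \<Rightarrow> real) \<Rightarrow> bool" where
  "maximal_solution F y0 J Y \<longleftrightarrow>
     solves_cauchy F y0 J Y \<and>
     (\<forall>J' Y'. solves_cauchy F y0 J' Y' \<and> J \<subseteq> J' \<and> (\<forall>t\<in>J. Y' t = Y t) \<longrightarrow> J' = J)"

definition Z ::
  "(real \<Rightarrow> real) \<Rightarrow> (real \<Rightarrow> real) \<Rightarrow> real \<Rightarrow> real \<Rightarrow> real \<Rightarrow> real \<Rightarrow> real set \<times> (real \<Rightarrow> real)" where
  "Z q k \<mu> \<gamma> y0 l = (THE (J, Y). maximal_solution (\<lambda>t y. Phi q k \<mu> \<gamma> t y l) y0 J Y)"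

definition diverges_to_infinity :: "real set \<times> (real \<Rightarrow> real) \<Rightarrow> bool" where
  "diverges_to_infinity = (\<lambda>(J, Y). J = {0..} \<and> filterlim Y at_top at_top)"


section \<open>The bisection algorithm\<close>

text \<open>
  \<open>search_interval q k \<mu> \<gamma> a b n\<close> is the current pair of endpoints when iteration \<open>n\<close> starts. The number
  \<open>N\<close> of iterations only determines where the computation stops and has no influence on the
  iterates produced before, so it is not a parameter of the sequence \<open>iterate\<close>.
\<close>

primrec search_interval ::
  "(real \<Rightarrow> real) \<Rightarrow> (real \<Rightarrow> real) \<Rightarrow> real \<Rightarrow> real \<Rightarrow> real \<Rightarrow> real \<Rightarrow> nat \<Rightarrow> real \<times> real" where
  "search_interval q k \<mu> \<gamma> a b 0 = (a, b)"
| "search_interval q k \<mu> \<gamma> a b (Suc n) =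
     (let (l, u) = search_interval q k \<mu> \<gamma> a b n; c = (l + u) / 2
      in if \<not> diverges_to_infinity (Z q k \<mu> \<gamma> c c) then (c, u) else (l, c))"

definition iterate ::
  "(real \<Rightarrow> real) \<Rightarrow> (real \<Rightarrow> real) \<Rightarrow> real \<Rightarrow> real \<Rightarrow> real \<Rightarrow> real \<Rightarrow> nat \<Rightarrow> real \<Rightarrow> real" where
  "iterate q k \<mu> \<gamma> a b n =
     (let (l, u) = search_interval q k \<mu> \<gamma> a b n; c = (l + u) / 2 in snd (Z q k \<mu> \<gamma> c c))"

end

theory Submission
  imports Defs
begin

text \<open>
  Let \<open>Y\<close> solve \<open>Y' = \<Phi>(t, Y, c)\<close>, \<open>Y 0 = c\<close> on the whole half-line. Since
  \<open>\<pi> v\<close> is the expectation of \<open>max 0 (v - C)\<close>, the equation says that \<open>Y\<close> satisfies the Bellman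
  equation of the auction problem in which a win is rewarded by the additional lump sum \<open>c = Y 0\<close>,
  the value of restarting at age \<open>0\<close>. If \<open>Y\<close> stays non-negative (in particular, if it diverges), it
  is a supersolution, and iterating the one-auction inequality shows that no policy earns more than
  \<open>c\<close>. If \<open>Y\<close> does not diverge, then either \<open>Y\<close> is bounded, or it becomes negative, in which case \<open>Y\<close>
  is replaced by \<open>0\<close> from its first zero on. Both give a bounded non-negative subsolution, and the
  policy that bids \<open>k + c - Y\<close> earns at least \<open>c\<close>. Hence the optimal value never leaves the search
  interval, whose length is halved in each iteration.
\<close>

section \<open>Differential equations with countably many exceptional times\<close>

text \<open>Since \<open>k\<close> may jump, solutions are differentiable only off a countable set
  of times, and every comparison rests on a monotonicity criterion that tolerates such a set.
  \<open>Phi\<close> is Lipschitz in its second argument, also at negative values, so a solution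
  exists on the whole half-line, and \<open>Z\<close> is its restriction to the times up to which it
  has stayed non-negative. Prices need not be integrable, so a policy may lose infinitely much.
  Positive and negative parts of the payoffs are therefore accumulated separately in
  \<open>ennreal\<close>, and inequalities are kept as sums on both sides until the end. The rate
  \<open>\<mu> + \<gamma>\<close> in the Bellman integral combines the density of the waiting time
  with the discount; for a solution \<open>Y\<close>, the function
  \<open>- exp (- (\<mu> + \<gamma>) * x) * Y (a + x)\<close> is an antiderivative of the integrand
  off the jumps. The two verification arguments are not symmetric. After \<open>n\<close> auctions a
  non-negative continuation value is left over. An upper bound may drop it, so a supersolution may
  diverge; in a lower bound it has to vanish in the limit, which is why the subsolution must be
  bounded.\<close>

lemma nondecreasing_if_derivative_nonneg_off_countable:
  fixes f :: "real \<Rightarrow> real"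
  assumes "a \<le> b" and cont: "continuous_on {a..b} f" and S: "countable S"
    and deriv: "\<And>x. x \<in> {a..b} - S \<Longrightarrow> \<exists>D\<ge>0. (f has_real_derivative D) (at x within {a..b})"
  shows "f a \<le> f b"
proof (rule ccontr)
  assume "\<not> f a \<le> f b"
  with \<open>a \<le> b\<close> have "a < b" "f b < f a"
    by (auto simp: le_less)
  \<comment> \<open>Half the average rate of descent: tilting \<open>f\<close> by this slope makes
    the derivatives off \<open>S\<close> strictly positive, yet \<open>g\<close> still falls from
    \<open>a\<close> to \<open>b\<close>.\<close>
  define e where "e = (f a - f b) / (2 * (b - a))"
  have "e > 0"
    using \<open>a < b\<close> \<open>f b < f a\<close> by (simp add: e_def)
  define g where "g x = f x + e * (x - a)" for x
  have cont_g: "continuous_on {a..b} g"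
    unfolding g_def by (intro continuous_intros cont)
  have "e * (b - a) = (f a - f b) / 2"
    using \<open>a < b\<close> by (simp add: e_def field_simps)
  then have "g b < g a"
    using \<open>f b < f a\<close> by (simp add: g_def field_simps)
  \<comment> \<open>Exceptional times attain only countably many levels, so some level
    \<open>y\<close> is missed by all of them. At the last point where \<open>g\<close> is at least
    \<open>y\<close> it equals \<open>y\<close>; the derivative there is positive, so
    \<open>g\<close> exceeds \<open>y\<close> further right.\<close>
  then have "uncountable ({g b<..<g a} - g ` S)"
    using S by (intro uncountable_minus_countable countable_image) (simp add: uncountable_open_interval)
  then have "{g b<..<g a} - g ` S \<noteq> {}"
    using countable_empty by metis
  then obtain y where y: "g b < y" "y < g a" "y \<notin> g ` S"
    unfolding ex_in_conv[symmetric] Diff_iff greaterThanLessThan_iff by (elim exE conjE)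
  define A where "A = {a..b} \<inter> g -` {y..}"
  have "closed A"
    unfolding A_def using cont_g by (intro continuous_closed_preimage) auto
  then have "compact A"
    using compact_Int_closed[of "{a..b}" A] by (simp add: A_def Int_absorb1)
  moreover have "a \<in> A"
    using y \<open>a < b\<close> by (simp add: A_def)
  ultimately obtain x where x: "x \<in> A" "\<And>z. z \<in> A \<Longrightarrow> z \<le> x"
    using compact_attains_sup[of A] by blast
  have x_ab: "x \<in> {a..b}" and "y \<le> g x"
    using x(1) by (auto simp: A_def)
  have "\<exists>z\<ge>x. z \<le> b \<and> g z = y"
    using x_ab y \<open>y \<le> g x\<close> cont_g by (intro IVT2') (auto intro: continuous_on_subset)
  then obtain z where z: "x \<le> z" "z \<le> b" "g z = y"
    by blast
  then have "z \<in> A"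
    using x_ab by (auto simp: A_def)
  then have "g x = y"
    using x(2) z by force
  then have "x \<notin> S" "x < b"
    using y x_ab by (auto simp: le_less)
  obtain D where D: "D \<ge> 0" "(f has_real_derivative D) (at x within {a..b})"
    using deriv x_ab \<open>x \<notin> S\<close> by blast
  have "(g has_real_derivative (D + e)) (at x within {a..b})"
    unfolding g_def by (rule derivative_eq_intros D refl | simp)+
  then obtain d where d: "d > 0" "\<And>h. h > 0 \<Longrightarrow> x + h \<in> {a..b} \<Longrightarrow> h < d \<Longrightarrow> g x < g (x + h)"
    using has_real_derivative_pos_inc_right[of g "D + e" x "{a..b}"] D(1) \<open>e > 0\<close> by auto
  define h where "h = min (d / 2) (b - x)"
  have h: "h > 0" "x + h \<in> {a..b}" "h < d"
    using d(1) \<open>x < b\<close> x_ab by (auto simp: h_def)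
  then have "x + h \<in> A"
    using d(2)[of h] \<open>g x = y\<close> by (auto simp: A_def)
  then show False
    using x(2) h(1) by force
qed

section \<open>Integrals with a variable upper endpoint on the half-line\<close>

lemma integrable_on_interval_if_bounded:
  fixes f :: "real \<Rightarrow> real"
  assumes "f \<in> borel_measurable borel" and "\<And>x. x \<in> {a..b} \<Longrightarrow> \<bar>f x\<bar> \<le> B"
  shows "f integrable_on {a..b}"
proof (rule measurable_bounded_by_integrable_imp_integrable_real)
  show "f \<in> borel_measurable (lebesgue_on {a..b})"
    using assms(1) by (intro measurable_restrict_space1 measurable_completion) simp
qed (use assms(2) in auto)

lemma continuous_on_atLeast_if_intervals:
  fixes f :: "real \<Rightarrow> 'b::topological_space"
  assumes "\<And>b. continuous_on {a..b} f"
  shows "continuous_on {a..} f"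
  unfolding continuous_on_eq_continuous_within
proof
  fix t assume "t \<in> {a..}"
  then have "continuous (at t within {a..t + 1}) f"
    using assms[of "t + 1"] by (simp add: continuous_on_eq_continuous_within)
  moreover have "at t within {a..} = at t within {a..t + 1}"
    by (rule at_within_nhd[of _ "{..<t + 1}"]) auto
  ultimately show "continuous (at t within {a..}) f"
    by simp
qed

lemma continuous_on_atLeast_integral:
  fixes f :: "real \<Rightarrow> real"
  assumes "\<And>b. f integrable_on {a..b}"
  shows "continuous_on {a..} (\<lambda>x. integral {a..x} f)"
  using assms by (intro continuous_on_atLeast_if_intervals indefinite_integral_continuous_1)

lemma has_real_derivative_integral_atLeast:
  fixes f :: "real \<Rightarrow> real"
  assumes "\<And>b. f integrable_on {a..b}" and "a \<le> t" and "continuous (at t within {a..}) f"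
  shows "((\<lambda>x. integral {a..x} f) has_real_derivative f t) (at t within {a..})"
proof -
  have eq: "at t within {a..} = at t within {a..t + 1}"
    by (rule at_within_nhd[of _ "{..<t + 1}"]) auto
  show ?thesis
    using integral_has_vector_derivative_continuous_at[of f a "t + 1" t "{}"] assms
    by (simp add: eq has_real_derivative_iff_has_vector_derivative)
qed

text \<open>
  Picard iteration in the norm weighted by \<open>exp (- 2 L t)\<close>, in which the integral operator is a
  contraction with constant \<open>1 / 2\<close> on the whole half-line.
\<close>

lemma global_cauchy_solution_exists:
  fixes F :: "real \<Rightarrow> real \<Rightarrow> real"
  assumes "L > 0" and lip: "\<And>t y z. \<bar>F t y - F t z\<bar> \<le> L * \<bar>y - z\<bar>"
    and bound: "\<And>t. \<bar>F t 0\<bar> \<le> K"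
    and meas: "\<And>Y. Y \<in> borel_measurable borel \<Longrightarrow> (\<lambda>t. F t (Y t)) \<in> borel_measurable borel"
    and cont: "\<And>t Y. t \<notin> S \<Longrightarrow> continuous (at t within {0..}) Y \<Longrightarrow>
      continuous (at t within {0..}) (\<lambda>s. F s (Y s))"
  obtains Y where "Y 0 = y0" "continuous_on {0..} Y"
    "\<And>t. 0 \<le> t \<Longrightarrow> t \<notin> S \<Longrightarrow> (Y has_real_derivative F t (Y t)) (at t within {0..})"
proof -
  have growth: "\<bar>F t y\<bar> \<le> K + L * \<bar>y\<bar>" for t y
    using lip[of t y 0] bound[of t] by simp
  have "K \<ge> 0"
    using bound[of 0] by simp
  \<comment> \<open>The unknown is \<open>u s = exp (- 2 * L * s) * Y s\<close>: the weight makes a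
    solution of exponential growth bounded, so the iteration runs in the space of bounded continuous
    functions.\<close>
  define w where "w u s = F s (exp (2 * L * s) * apply_bcontfun u s)" for u :: "real \<Rightarrow>\<^sub>C real" and s
  have w_meas: "w u \<in> borel_measurable borel" for u
    unfolding w_def
    by (intro meas borel_measurable_continuous_onI continuous_intros)
       (auto intro!: continuous_on_apply_bcontfun)
  have u_bound: "\<bar>apply_bcontfun u s\<bar> \<le> norm u" for u :: "real \<Rightarrow>\<^sub>C real" and s
    using norm_bounded[of u s] by simp
  have w_bound: "\<bar>w u s\<bar> \<le> K + norm u * (L * exp (2 * L * s))" for u s
  proof -
    have "\<bar>exp (2 * L * s) * apply_bcontfun u s\<bar> \<le> exp (2 * L * s) * norm u"
      using u_bound[of u s] by (simp add: abs_mult)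
    with growth[of s "exp (2 * L * s) * apply_bcontfun u s"] show ?thesis
      unfolding w_def using \<open>L > 0\<close> by (smt (verit) mult_left_mono mult.assoc mult.commute)
  qed
  have w_int: "w u integrable_on {0..b}" for u b
  proof (rule integrable_on_interval_if_bounded[OF w_meas])
    fix s assume "s \<in> {0..b}"
    then have "norm u * (L * exp (2 * L * s)) \<le> norm u * (L * exp (2 * L * b))"
      using \<open>L > 0\<close> by (intro mult_left_mono) auto
    with w_bound[of u s] show "\<bar>w u s\<bar> \<le> K + norm u * (L * exp (2 * L * b))"
      by linarith
  qed
  \<comment> \<open>Source of the contraction constant: the integral is at most half of
    \<open>exp (2 * L * t)\<close>, and the weight cancels the exponential.\<close>
  have exp_int: "((\<lambda>s. L * exp (2 * L * s)) has_integral (exp (2 * L * t) - 1) / 2) {0..t}"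
    if "t \<ge> 0" for t
  proof -
    have "((\<lambda>s. exp (2 * L * s) / 2) has_vector_derivative L * exp (2 * L * s))
        (at s within {0..t})" for s
      unfolding has_real_derivative_iff_has_vector_derivative[symmetric]
      by (rule derivative_eq_intros refl | simp)+
    from fundamental_theorem_of_calculus[OF that this] show ?thesis
      by (simp add: diff_divide_distrib)
  qed
  \<comment> \<open>The weighted integral operator. Bounded continuous functions live on the whole
    line, so \<open>max 0 t\<close> extends the image constantly to negative times.\<close>
  define T where "T u t = exp (- 2 * L * max 0 t) * (y0 + integral {0..max 0 t} (w u))" for u t
  have T_cont: "continuous_on UNIV (T u)" for u
  proof -
    have "continuous_on UNIV (\<lambda>t. integral {0..max 0 t} (w u))"
      by (rule continuous_on_compose2[OF continuous_on_atLeast_integral[OF w_int]])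
         (auto intro!: continuous_intros)
    then show ?thesis
      unfolding T_def by (intro continuous_intros)
  qed
  have T_bound: "norm (T u t) \<le> \<bar>y0\<bar> + K / L + norm u" for u t
  proof -
    define s where "s = max 0 t"
    have "s \<ge> 0"
      by (simp add: s_def)
    have "\<bar>integral {0..s} (w u)\<bar> \<le> integral {0..s} (\<lambda>r. K + norm u * (L * exp (2 * L * r)))"
      using w_int w_bound[of u] exp_int[OF \<open>s \<ge> 0\<close>, THEN has_integral_integrable]
      by (intro Henstock_Kurzweil_Integration.integral_norm_bound_integral[where 'a=real, unfolded real_norm_def])
         (auto intro!: Henstock_Kurzweil_Integration.integrable_add integrable_on_mult_right)
    also have "\<dots> = K * s + norm u * ((exp (2 * L * s) - 1) / 2)"
    proof -
      have "((\<lambda>r. K + norm u * (L * exp (2 * L * r))) has_integral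
          K * s + norm u * ((exp (2 * L * s) - 1) / 2)) {0..s}"
        using \<open>s \<ge> 0\<close> has_integral_const_real[of K 0 s]
        by (intro has_integral_add has_integral_mult_right exp_int) (auto simp: mult.commute)
      then show ?thesis
        by (rule integral_unique)
    qed
    also have "\<dots> \<le> exp (2 * L * s) * (K / L + norm u)"
    proof -
      have "L * s \<le> exp (2 * L * s)"
        using exp_ge_add_one_self[of "2 * L * s"] mult_nonneg_nonneg[of L s] \<open>s \<ge> 0\<close> \<open>L > 0\<close>
        by linarith
      then have "K / L * (L * s) \<le> K / L * exp (2 * L * s)"
        using \<open>K \<ge> 0\<close> \<open>L > 0\<close> by (intro mult_left_mono) auto
      then have "K * s \<le> exp (2 * L * s) * (K / L)"
        using \<open>L > 0\<close> by (simp add: mult.commute)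
      moreover have "norm u * ((exp (2 * L * s) - 1) / 2) \<le> norm u * exp (2 * L * s)"
      proof (rule mult_left_mono)
        have "(e - 1) / 2 \<le> e" if "e > 0" for e :: real
          using that by simp
        then show "(exp (2 * L * s) - 1) / 2 \<le> exp (2 * L * s)"
          using exp_gt_zero .
      qed simp
      ultimately show ?thesis
        unfolding distrib_left by (metis add_mono mult.commute)
    qed
    finally have "exp (- 2 * L * s) * \<bar>integral {0..s} (w u)\<bar> \<le> K / L + norm u"
      using mult_left_mono[of _ _ "exp (- 2 * L * s)"]
      by (simp add: exp_minus field_simps)
    moreover have "exp (- 2 * L * s) * \<bar>y0\<bar> \<le> \<bar>y0\<bar>"
      using \<open>s \<ge> 0\<close> \<open>L > 0\<close> by (intro mult_left_le_one_le) auto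
    ultimately have "exp (- 2 * L * s) * (\<bar>y0\<bar> + \<bar>integral {0..s} (w u)\<bar>) \<le> \<bar>y0\<bar> + K / L + norm u"
      by (simp add: distrib_left)
    moreover have "norm (T u t) \<le> exp (- 2 * L * s) * (\<bar>y0\<bar> + \<bar>integral {0..s} (w u)\<bar>)"
      by (simp add: T_def s_def abs_mult)
    ultimately show ?thesis
      by linarith
  qed
  define U where "U u = Bcontfun (T u)" for u
  have U: "apply_bcontfun (U u) = T u" for u
    unfolding U_def using bcontfun_normI[OF T_cont T_bound] by (rule Bcontfun_inverse)
  have contraction: "dist (U u) (U v) \<le> 1 / 2 * dist u v" for u v
  proof (rule dist_bound)
    fix t :: real
    define s where "s = max 0 t"
    have "s \<ge> 0"
      by (simp add: s_def)
    have "\<bar>integral {0..s} (w u) - integral {0..s} (w v)\<bar> = \<bar>integral {0..s} (\<lambda>r. w u r - w v r)\<bar>"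
      by (simp add: Henstock_Kurzweil_Integration.integral_diff w_int)
    also have "\<dots> \<le> integral {0..s} (\<lambda>r. dist u v * (L * exp (2 * L * r)))"
    proof (rule Henstock_Kurzweil_Integration.integral_norm_bound_integral[where 'a=real, unfolded real_norm_def])
      fix r
      have "\<bar>w u r - w v r\<bar> \<le> L * \<bar>exp (2 * L * r) * apply_bcontfun u r - exp (2 * L * r) * apply_bcontfun v r\<bar>"
        unfolding w_def by (rule lip)
      also have "\<dots> = L * exp (2 * L * r) * dist (apply_bcontfun u r) (apply_bcontfun v r)"
        by (simp add: dist_real_def abs_mult flip: right_diff_distrib)
      also have "\<dots> \<le> L * exp (2 * L * r) * dist u v"
        using \<open>L > 0\<close> by (intro mult_left_mono dist_bounded) auto
      finally show "\<bar>w u r - w v r\<bar> \<le> dist u v * (L * exp (2 * L * r))"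
        by (simp add: mult_ac)
    qed (use w_int exp_int[OF \<open>s \<ge> 0\<close>, THEN has_integral_integrable] in \<open>auto intro!: Henstock_Kurzweil_Integration.integrable_diff integrable_on_mult_right\<close>)
    also have "\<dots> = dist u v * ((exp (2 * L * s) - 1) / 2)"
      using exp_int[OF \<open>s \<ge> 0\<close>] by (intro integral_unique has_integral_mult_right)
    also have "\<dots> \<le> dist u v * (exp (2 * L * s) / 2)"
      by (intro mult_left_mono) auto
    finally have "exp (- 2 * L * s) * \<bar>integral {0..s} (w u) - integral {0..s} (w v)\<bar> \<le> dist u v / 2"
      using mult_left_mono[of _ _ "exp (- 2 * L * s)"] by (simp add: exp_minus field_simps)
    moreover have "dist (T u t) (T v t) = exp (- 2 * L * s) * \<bar>integral {0..s} (w u) - integral {0..s} (w v)\<bar>"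
      by (simp add: T_def s_def dist_real_def abs_mult flip: right_diff_distrib)
    ultimately show "dist (apply_bcontfun (U u) t) (apply_bcontfun (U v) t) \<le> 1 / 2 * dist u v"
      by (simp add: U)
  qed
  then obtain u where "U u = u"
    using banach_fix_type[of "1 / 2" U] by auto
  then have u: "apply_bcontfun u = T u"
    using U[of u] by simp
  define Y where "Y t = exp (2 * L * t) * apply_bcontfun u t" for t
  have Y_eq: "Y t = y0 + integral {0..t} (w u)" if "t \<ge> 0" for t
  proof -
    have "Y t = exp (2 * L * t) * T u t"
      by (simp add: Y_def u)
    also have "\<dots> = y0 + integral {0..t} (w u)"
      using that by (simp add: T_def exp_minus)
    finally show ?thesis .
  qed
  have w_Y: "w u = (\<lambda>s. F s (Y s))"
    by (simp add: fun_eq_iff w_def Y_def)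
  have Y_cont: "continuous_on UNIV Y"
    unfolding Y_def by (intro continuous_intros) (auto intro!: continuous_on_apply_bcontfun)
  show ?thesis
  proof (rule that)
    show "Y 0 = y0"
      using Y_eq[of 0] by simp
    show "continuous_on {0..} Y"
      using Y_cont by (rule continuous_on_subset) simp
    fix t assume t: "0 \<le> t" "t \<notin> S"
    have "continuous (at t within {0..}) Y"
      using Y_cont t(1) by (meson continuous_on_eq_continuous_within UNIV_I continuous_within_subset subset_UNIV)
    then have "continuous (at t within {0..}) (w u)"
      unfolding w_Y by (rule cont[OF t(2)])
    then have "((\<lambda>x. y0 + integral {0..x} (w u)) has_real_derivative w u t) (at t within {0..})"
      using has_real_derivative_integral_atLeast[OF w_int t(1)]
      by (auto intro!: derivative_eq_intros)
    then have "(Y has_real_derivative w u t) (at t within {0..})"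
      by (rule has_field_derivative_transform_within[where d=1]) (use t Y_eq in auto)
    then show "(Y has_real_derivative F t (Y t)) (at t within {0..})"
      by (simp add: w_Y)
  qed
qed

section \<open>Uniqueness, comparison and maximal solutions\<close>

lemma cauchy_solution_unique_on_interval:
  fixes F :: "real \<Rightarrow> real \<Rightarrow> real"
  assumes lip: "\<And>t y z. \<bar>F t y - F t z\<bar> \<le> L * \<bar>y - z\<bar>"
    and "0 \<le> t" and "Y 0 = V 0"
    and contY: "continuous_on {0..t} Y" and contV: "continuous_on {0..t} V"
    and S: "countable S"
    and derivY: "\<And>s. s \<in> {0..t} - S \<Longrightarrow> (Y has_real_derivative F s (Y s)) (at s within {0..t})"
    and derivV: "\<And>s. s \<in> {0..t} - S \<Longrightarrow> (V has_real_derivative F s (V s)) (at s within {0..t})"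
  shows "Y t = V t"
proof -
  \<comment> \<open>The squared distance of the solutions grows at rate at most
    \<open>2 * L\<close>. Damped by that rate and negated, it is non-decreasing, starts at 0 and is
    never positive, so it vanishes.\<close>
  define E where "E s = - (exp (- 2 * L * s) * (Y s - V s)\<^sup>2)" for s
  have "E 0 \<le> E t"
  proof (rule nondecreasing_if_derivative_nonneg_off_countable[OF \<open>0 \<le> t\<close> _ S])
    show "continuous_on {0..t} E"
      unfolding E_def by (intro continuous_intros contY contV)
    fix s assume s: "s \<in> {0..t} - S"
    define d where "d = Y s - V s"
    define d' where "d' = F s (Y s) - F s (V s)"
    have "(E has_real_derivative exp (- 2 * L * s) * (2 * (L * d\<^sup>2 - d * d'))) (at s within {0..t})"
      unfolding E_def
      by (rule derivative_eq_intros derivY[OF s] derivV[OF s] refl)+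
         (simp add: d_def d'_def power2_eq_square algebra_simps)
    moreover have "d * d' \<le> L * d\<^sup>2"
    proof -
      have "d * d' \<le> \<bar>d\<bar> * \<bar>d'\<bar>"
        by (simp flip: abs_mult)
      also have "\<dots> \<le> \<bar>d\<bar> * (L * \<bar>d\<bar>)"
        unfolding d_def d'_def by (intro mult_left_mono lip) simp
      also have "\<dots> = L * d\<^sup>2"
        by (simp add: power2_eq_square)
      finally show ?thesis .
    qed
    ultimately show "\<exists>D\<ge>0. (E has_real_derivative D) (at s within {0..t})"
      by (intro exI[of _ "exp (- 2 * L * s) * (2 * (L * d\<^sup>2 - d * d'))"]) simp
  qed
  then have "exp (- 2 * L * t) * (Y t - V t)\<^sup>2 \<le> 0"
    using \<open>Y 0 = V 0\<close> by (simp add: E_def)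
  then show ?thesis
    by (simp add: mult_le_0_iff)
qed

text \<open>One half of the fundamental theorem of calculus: \<open>g\<close> minus the integral of
  \<open>w\<close> is non-decreasing. It turns differential inequalities that may fail on a
  countable set into integral inequalities.\<close>

lemma integral_le_if_derivative_ge:
  fixes g w :: "real \<Rightarrow> real"
  assumes w: "\<And>c. w integrable_on {0..c}" and "0 \<le> b" and S: "countable S"
    and w_cont: "\<And>x. 0 \<le> x \<Longrightarrow> x \<notin> S \<Longrightarrow> continuous (at x within {0..}) w"
    and g_cont: "continuous_on {0..} g"
    and deriv: "\<And>x. 0 \<le> x \<Longrightarrow> x \<notin> S \<Longrightarrow> \<exists>D\<ge>w x. (g has_real_derivative D) (at x within {0..})"
  shows "integral {0..b} w \<le> g b - g 0"
proof -
  define f where "f x = g x - integral {0..x} w" for x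
  have "f 0 \<le> f b"
  proof (rule nondecreasing_if_derivative_nonneg_off_countable[OF \<open>0 \<le> b\<close> _ S])
    have "continuous_on {0..} f"
      unfolding f_def by (intro continuous_intros g_cont continuous_on_atLeast_integral w)
    then show "continuous_on {0..b} f"
      by (rule continuous_on_subset) auto
    fix x assume x: "x \<in> {0..b} - S"
    then obtain D where D: "w x \<le> D" "(g has_real_derivative D) (at x within {0..})"
      using deriv by force
    have "((\<lambda>x. integral {0..x} w) has_real_derivative w x) (at x within {0..})"
      using x by (intro has_real_derivative_integral_atLeast w w_cont) auto
    then have "(f has_real_derivative D - w x) (at x within {0..})"
      unfolding f_def by (intro DERIV_diff D(2))
    then have "(f has_real_derivative D - w x) (at x within {0..b})"
      by (rule has_field_derivative_subset) auto
    with D(1) show "\<exists>D\<ge>0. (f has_real_derivative D) (at x within {0..b})"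
      by (intro exI[of _ "D - w x"]) simp
  qed
  then show ?thesis
    by (simp add: f_def)
qed

lemma nn_integral_interval_eq_integral:
  fixes w :: "real \<Rightarrow> real"
  assumes "\<And>x. 0 \<le> x \<Longrightarrow> 0 \<le> w x" and "w integrable_on {0..b}"
  shows "(\<integral>\<^sup>+x. ennreal (w x) * indicator {0..b} x \<partial>lborel) = ennreal (integral {0..b} w)"
  by (rule nn_integral_has_integral_lebesgue') (use assms in \<open>auto simp: integrable_integral\<close>)

lemma nn_integral_atLeast_le:
  fixes w :: "real \<Rightarrow> real"
  assumes [measurable]: "w \<in> borel_measurable borel"
    and le: "\<And>n :: nat. (\<integral>\<^sup>+x. ennreal (w x) * indicator {0..real n} x \<partial>lborel) \<le> B"
  shows "(\<integral>\<^sup>+x. ennreal (w x) * indicator {0..} x \<partial>lborel) \<le> B"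
proof (rule LIMSEQ_le_const2)
  show "(\<lambda>n. \<integral>\<^sup>+x. ennreal (w x) * indicator {0..real n} x \<partial>lborel) \<longlonglongrightarrow>
      (\<integral>\<^sup>+x. ennreal (w x) * indicator {0..} x \<partial>lborel)"
  proof (rule nn_integral_LIMSEQ)
    show "incseq (\<lambda>n x. ennreal (w x) * indicator {0..real n} x)"
      by (auto simp: incseq_def le_fun_def indicator_def)
    fix x :: real
    have "\<forall>\<^sub>F n in sequentially. ennreal (w x) * indicator {0..real n} x = ennreal (w x) * indicator {0..} x"
      using eventually_ge_at_top[of "nat \<lceil>x\<rceil>"] by eventually_elim (auto simp: indicator_def)
    then show "(\<lambda>n. ennreal (w x) * indicator {0..real n} x) \<longlonglongrightarrow> ennreal (w x) * indicator {0..} x"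
      by (rule tendsto_eventually)
  qed measurable
qed (use le in auto)

text \<open>\<open>Y\<close> lives on the whole half-line but may become negative, which
  \<open>solves_cauchy\<close> forbids; \<open>J\<close> consists of the times up to which it has
  not. By uniqueness every solution agrees with \<open>Y\<close> on its interval, which therefore
  lies in \<open>J\<close>, so the restriction of \<open>Y\<close> to \<open>J\<close> extends all
  solutions.\<close>

lemma maximal_solution_iff:
  fixes F :: "real \<Rightarrow> real \<Rightarrow> real"
  assumes lip: "\<And>t y z. \<bar>F t y - F t z\<bar> \<le> L * \<bar>y - z\<bar>"
    and "0 \<le> y0" and Y0: "Y 0 = y0" and contY: "continuous_on {0..} Y" and S: "countable S"
    and derivY: "\<And>t. 0 \<le> t \<Longrightarrow> t \<notin> S \<Longrightarrow> (Y has_real_derivative F t (Y t)) (at t within {0..})"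
  defines "J \<equiv> {t. 0 \<le> t \<and> (\<forall>s\<in>{0..t}. 0 \<le> Y s)}"
  shows "maximal_solution F y0 I V \<longleftrightarrow> I = J \<and> V = restrict Y J"
proof -
  have J_nonneg: "J \<subseteq> {0..}"
    by (auto simp: J_def)
  have solves: "solves_cauchy F y0 J (restrict Y J)"
    unfolding solves_cauchy_def
  proof (intro conjI)
    show "is_interval J"
      by (auto simp: is_interval_1 J_def)
    show "0 \<in> J" and "restrict Y J 0 = y0"
      using \<open>0 \<le> y0\<close> Y0 by (auto simp: J_def)
    show "\<forall>t\<in>J. 0 \<le> restrict Y J t"
      by (auto simp: J_def)
    show "continuous_on J (restrict Y J)"
      using continuous_on_subset[OF contY J_nonneg] by (simp cong: continuous_on_cong)
    have "(restrict Y J has_real_derivative F t (restrict Y J t)) (at t within J)" if "t \<in> J - S" for t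
    proof -
      have "(Y has_real_derivative F t (Y t)) (at t within J)"
        using derivY that J_nonneg has_field_derivative_subset by fastforce
      then have "(restrict Y J has_real_derivative F t (Y t)) (at t within J)"
        by (rule has_field_derivative_transform_within[where d=1]) (use that in auto)
      then show ?thesis
        using that by simp
    qed
    then show "\<exists>S. countable S \<and>
        (\<forall>t\<in>J - S. (restrict Y J has_real_derivative F t (restrict Y J t)) (at t within J))"
      using S by blast
  qed (use J_nonneg in auto)
  have unique: "I \<subseteq> J \<and> (\<forall>t\<in>I. V t = Y t)" if sol: "solves_cauchy F y0 I V" for I V
  proof -
    obtain S' where S': "countable S'"
      "\<And>t. t \<in> I - S' \<Longrightarrow> (V has_real_derivative F t (V t)) (at t within I)"
      using sol by (auto simp: solves_cauchy_def)
    have I: "{0..t} \<subseteq> I" "0 \<le> t" if "t \<in> I" for t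
      using sol that by (auto simp: solves_cauchy_def is_interval_1)
    have eq: "V t = Y t" if "t \<in> I" for t
    \<comment> \<open>Each solution has its own exceptional set, so they are compared off the
      union.\<close>
    proof (rule cauchy_solution_unique_on_interval[of F L t V Y "S \<union> S'"])
      show "continuous_on {0..t} V"
        using sol I(1)[OF that] by (auto simp: solves_cauchy_def intro: continuous_on_subset)
      show "continuous_on {0..t} Y"
        using contY by (rule continuous_on_subset) auto
      show "(V has_real_derivative F s (V s)) (at s within {0..t})" if "s \<in> {0..t} - (S \<union> S')" for s
      proof -
        have "s \<in> I - S'"
          using that I(1)[OF \<open>t \<in> I\<close>] by auto
        from has_field_derivative_subset[OF S'(2)[OF this] I(1)[OF \<open>t \<in> I\<close>]] show ?thesis .
      qed
      show "(Y has_real_derivative F s (Y s)) (at s within {0..t})" if "s \<in> {0..t} - (S \<union> S')" for s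
        using derivY[of s] that by (auto intro: has_field_derivative_subset)
    qed (use lip S S'(1) I(2) that sol Y0 in \<open>auto simp: solves_cauchy_def\<close>)
    have "t \<in> J" if "t \<in> I" for t
    proof -
      have "0 \<le> Y s" if "s \<in> {0..t}" for s
      proof -
        have "s \<in> I"
          using I(1)[OF \<open>t \<in> I\<close>] that by blast
        then show ?thesis
          using sol eq[of s] unfolding solves_cauchy_def by fastforce
      qed
      then show ?thesis
        using I(2)[OF that] by (simp add: J_def)
    qed
    with eq show ?thesis
      by blast
  qed
  show ?thesis
  proof
    assume max: "maximal_solution F y0 I V"
    then have sol: "solves_cauchy F y0 I V"
      by (simp add: maximal_solution_def)
    then have "I \<subseteq> J" "\<forall>t\<in>I. restrict Y J t = V t"
      using unique[OF sol] by auto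
    then have "J = I"
      using max solves unfolding maximal_solution_def by blast
    moreover have "V = restrict Y J"
      using sol unique[OF sol] \<open>J = I\<close>
      by (intro extensionalityI[of V J]) (auto simp: solves_cauchy_def)
    ultimately show "I = J \<and> V = restrict Y J"
      by simp
  next
    assume "I = J \<and> V = restrict Y J"
    then show "maximal_solution F y0 I V"
      using solves unique unfolding maximal_solution_def by blast
  qed
qed

text \<open>Solutions live on non-negative times; this permits \<open>k\<close> to be altered at
  negative ages without changing \<open>Z\<close>.\<close>

lemma maximal_solution_cong:
  assumes "\<And>t y. 0 \<le> t \<Longrightarrow> F t y = G t y"
  shows "maximal_solution F y0 J Y \<longleftrightarrow> maximal_solution G y0 J Y"
proof -
  have "solves_cauchy F y0 J Y \<longleftrightarrow> solves_cauchy G y0 J Y" for J Y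
  proof (cases "J \<subseteq> {0..}")
    case True
    then have "F t (Y t) = G t (Y t)" if "t \<in> J" for t
      using that assms by auto
    then have "(\<forall>t\<in>J - S. (Y has_real_derivative F t (Y t)) (at t within J)) \<longleftrightarrow>
        (\<forall>t\<in>J - S. (Y has_real_derivative G t (Y t)) (at t within J))" for S
      by simp
    then show ?thesis
      by (simp add: solves_cauchy_def)
  qed (simp add: solves_cauchy_def)
  then show ?thesis
    by (simp add: maximal_solution_def)
qed

section \<open>Independence of an auction from its past\<close>

text \<open>\<open>post_age\<close> and \<open>elapsed\<close> at \<open>n\<close> refer to the moment just after auction \<open>n - 1\<close>, and to the start for \<open>n = 0\<close>.\<close>

definition post_age ::
  "(nat \<Rightarrow> 'a \<Rightarrow> real) \<Rightarrow> (nat \<Rightarrow> 'a \<Rightarrow> real) \<Rightarrow> (real \<Rightarrow> real) \<Rightarrow> real \<Rightarrow> nat \<Rightarrow> 'a \<Rightarrow> real" where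
  "post_age X C \<beta> \<tau> n \<omega> =
     (case n of 0 \<Rightarrow> \<tau> | Suc i \<Rightarrow> if \<beta> (age X C \<beta> \<tau> i \<omega>) > C i \<omega> then 0 else age X C \<beta> \<tau> i \<omega>)"

definition elapsed :: "(nat \<Rightarrow> 'a \<Rightarrow> real) \<Rightarrow> nat \<Rightarrow> 'a \<Rightarrow> real" where
  "elapsed X n \<omega> = (\<Sum>j<n. X j \<omega>)"

lemma age_eq_post_age: "age X C \<beta> \<tau> n \<omega> = post_age X C \<beta> \<tau> n \<omega> + X n \<omega>"
  by (cases n) (simp_all add: post_age_def)

lemma post_age_0 [simp]: "post_age X C \<beta> \<tau> 0 \<omega> = \<tau>"
  by (simp add: post_age_def)

lemma post_age_Suc:
  "post_age X C \<beta> \<tau> (Suc n) \<omega> =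
     (if \<beta> (age X C \<beta> \<tau> n \<omega>) > C n \<omega> then 0 else age X C \<beta> \<tau> n \<omega>)"
  by (simp add: post_age_def)

lemma elapsed_0 [simp]: "elapsed X 0 \<omega> = 0"
  by (simp add: elapsed_def)

lemma elapsed_Suc: "elapsed X (Suc n) \<omega> = elapsed X n \<omega> + X n \<omega>"
  by (simp add: elapsed_def)

lemma arrival_eq_elapsed: "arrival X n \<omega> = elapsed X n \<omega> + X n \<omega>"
  by (simp add: arrival_def elapsed_def flip: lessThan_Suc_atMost)

text \<open>Both the processes and the sample points may differ, because the same recursion is later
  evaluated on the coordinates of a product space.\<close>

lemma age_cong:
  assumes "\<And>i. i \<le> n \<Longrightarrow> X i \<omega> = X' i \<omega>'" and "\<And>i. i < n \<Longrightarrow> C i \<omega> = C' i \<omega>'"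
  shows "age X C \<beta> \<tau> n \<omega> = age X' C' \<beta> \<tau> n \<omega>'"
  using assms by (induction n) auto

lemma post_age_cong:
  assumes "\<And>i. i < n \<Longrightarrow> X i \<omega> = X' i \<omega>'" and "\<And>i. i < n \<Longrightarrow> C i \<omega> = C' i \<omega>'"
  shows "post_age X C \<beta> \<tau> n \<omega> = post_age X' C' \<beta> \<tau> n \<omega>'"
proof (cases n)
  case (Suc m)
  then have "age X C \<beta> \<tau> m \<omega> = age X' C' \<beta> \<tau> m \<omega>'"
    using assms by (intro age_cong) auto
  then show ?thesis
    using Suc assms(2)[of m] by (simp add: post_age_Suc)
qed simp

lemma measurable_age:
  assumes [measurable]: "\<beta> \<in> borel_measurable borel"
    and X: "\<And>i. i \<le> n \<Longrightarrow> X i \<in> borel_measurable N" and C: "\<And>i. i < n \<Longrightarrow> C i \<in> borel_measurable N"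
  shows "age X C \<beta> \<tau> n \<in> borel_measurable N"
  using X C
proof (induction n)
  case 0
  then have [measurable]: "X 0 \<in> borel_measurable N"
    by simp
  show ?case
    by simp
next
  case (Suc n)
  then have [measurable]: "X (Suc n) \<in> borel_measurable N" "C n \<in> borel_measurable N"
      "age X C \<beta> \<tau> n \<in> borel_measurable N"
    by auto
  show ?case
    by simp
qed

lemma measurable_post_age:
  assumes [measurable]: "\<beta> \<in> borel_measurable borel"
    and X: "\<And>i. i < n \<Longrightarrow> X i \<in> borel_measurable N" and C: "\<And>i. i < n \<Longrightarrow> C i \<in> borel_measurable N"
  shows "post_age X C \<beta> \<tau> n \<in> borel_measurable N"
proof (cases n)
  case (Suc m)
  then have [measurable]: "C m \<in> borel_measurable N" "age X C \<beta> \<tau> m \<in> borel_measurable N"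
    using X C by (auto intro!: measurable_age)
  have "post_age X C \<beta> \<tau> n = (\<lambda>\<omega>. if \<beta> (age X C \<beta> \<tau> m \<omega>) > C m \<omega> then 0 else age X C \<beta> \<tau> m \<omega>)"
    using Suc by (simp add: fun_eq_iff post_age_Suc)
  then show ?thesis
    by simp
next
  case 0
  have "post_age X C \<beta> \<tau> 0 = (\<lambda>\<omega>. \<tau>)"
    by (simp add: fun_eq_iff)
  then show ?thesis
    using 0 by simp
qed

context auction_model
begin

section \<open>Laws of gaps and prices, and their independence of the past\<close>

abbreviation "price_law \<equiv> distr M borel (C 0)"
abbreviation "gap_law \<equiv> density lborel (exponential_density \<mu>)"

lemma measurable_gap [measurable]: "X i \<in> borel_measurable M"
  using interarrival[of i] by (simp add: distributed_def)

lemma measurable_price [measurable]: "C i \<in> borel_measurable M"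
proof -
  have "case_sum X C (Inr i) \<in> borel_measurable M"
    using indep unfolding indep_vars_def by blast
  then show ?thesis
    by simp
qed

lemma distr_gap: "distr M borel (X i) = gap_law"
proof -
  have "distr M borel (X i) = distr M lborel (X i)"
    by (rule distr_cong) auto
  then show ?thesis
    using interarrival[of i] by (simp add: distributed_def)
qed

lemma distr_price: "distr M borel (C i) = price_law"
  by (intro cdf_unique real_distribution_distr) (auto simp: fun_eq_iff price_cdf)

lemma prob_space_price_law: "prob_space price_law"
  by (intro prob_space_distr) simp

lemma prob_space_gap_law: "prob_space gap_law"
  using prob_space_exponential_density[OF intensity_pos] .

lemma AE_gap_nonneg: "AE x in gap_law. 0 \<le> x"
  by (subst AE_density) (auto simp: exponential_density_def)

lemma AE_price_law_nonneg: "AE c in price_law. 0 \<le> c"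
  by (subst AE_distr_iff) (auto intro: price_nonneg)

lemma AE_gaps_nonneg: "AE \<omega> in M. \<forall>i. 0 \<le> X i \<omega>"
  unfolding AE_all_countable
proof
  fix i
  have "AE x in distr M borel (X i). 0 \<le> x"
    unfolding distr_gap by (rule AE_gap_nonneg)
  then show "AE \<omega> in M. 0 \<le> X i \<omega>"
    by (subst (asm) AE_distr_iff) auto
qed

lemma AE_history_nonneg:
  assumes "0 \<le> \<tau>"
  shows "AE \<omega> in M. \<forall>n. 0 \<le> age X C \<beta> \<tau> n \<omega> \<and> 0 \<le> post_age X C \<beta> \<tau> n \<omega> \<and>
    0 \<le> elapsed X n \<omega> \<and> 0 \<le> arrival X n \<omega>"
  using AE_gaps_nonneg
proof eventually_elim
  case (elim \<omega>)
  then have age: "0 \<le> age X C \<beta> \<tau> n \<omega>" for n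
    using assms by (induction n) auto
  moreover have "0 \<le> post_age X C \<beta> \<tau> n \<omega>" for n
    using age assms by (cases n) (auto simp: post_age_Suc)
  moreover have "0 \<le> elapsed X n \<omega>" "0 \<le> arrival X n \<omega>" for n
    using elim by (auto simp: elapsed_def arrival_def sum_nonneg)
  ultimately show ?case
    by blast
qed

lemma measurable_age' [measurable (raw)]:
  "\<beta> \<in> borel_measurable borel \<Longrightarrow> age X C \<beta> \<tau> n \<in> borel_measurable M"
  by (rule measurable_age) auto

lemma measurable_post_age' [measurable (raw)]:
  "\<beta> \<in> borel_measurable borel \<Longrightarrow> post_age X C \<beta> \<tau> n \<in> borel_measurable M"
  by (rule measurable_post_age) auto

lemma measurable_elapsed [measurable]: "elapsed X n \<in> borel_measurable M"
  unfolding elapsed_def by measurable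

lemma measurable_arrival [measurable]: "arrival X n \<in> borel_measurable M"
  unfolding arrival_def by measurable

text \<open>The history is a function of the gaps and prices with index below \<open>n\<close>, the
  auction consists of those with index \<open>n\<close>, and disjoint blocks of an independent
  family are independent.\<close>

lemma indep_history_auction:
  assumes [measurable]: "\<beta> \<in> borel_measurable borel"
  shows "indep_var (borel \<Otimes>\<^sub>M borel) (\<lambda>\<omega>. (elapsed X n \<omega>, post_age X C \<beta> \<tau> n \<omega>))
    (borel \<Otimes>\<^sub>M borel) (\<lambda>\<omega>. (X n \<omega>, C n \<omega>))"
proof -
  define A :: "(nat + nat) set" where "A = Inl ` {..<n} \<union> Inr ` {..<n}"
  define B :: "(nat + nat) set" where "B = {Inl n, Inr n}"
  \<comment> \<open>The coordinate maps serve as gap and price processes, with points of the product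
    space as sample points, so that the recursions themselves express the history as a function of
    the block \<open>A\<close>.\<close>
  define U :: "nat \<Rightarrow> (nat + nat \<Rightarrow> real) \<Rightarrow> real" where "U i w = w (Inl i)" for i w
  define V :: "nat \<Rightarrow> (nat + nat \<Rightarrow> real) \<Rightarrow> real" where "V i w = w (Inr i)" for i w
  define hA where "hA = (\<lambda>w. (elapsed U n w, post_age U V \<beta> \<tau> n w))"
  define hB where "hB = (\<lambda>w :: nat + nat \<Rightarrow> real. (w (Inl n), w (Inr n)))"
  have 1: "U i \<in> borel_measurable (PiM A (\<lambda>_. borel))" if "i < n" for i
    unfolding U_def using that by (intro measurable_component_singleton) (auto simp: A_def)
  have 2: "V i \<in> borel_measurable (PiM A (\<lambda>_. borel))" if "i < n" for i
    unfolding V_def using that by (intro measurable_component_singleton) (auto simp: A_def)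
  have "hA \<in> PiM A (\<lambda>_. borel) \<rightarrow>\<^sub>M borel \<Otimes>\<^sub>M borel"
    unfolding hA_def elapsed_def
    by (intro measurable_Pair borel_measurable_sum measurable_post_age assms) (auto intro: 1 2)
  moreover have "hB \<in> PiM B (\<lambda>_. borel) \<rightarrow>\<^sub>M borel \<Otimes>\<^sub>M borel"
    unfolding hB_def by (intro measurable_Pair measurable_component_singleton) (auto simp: B_def)
  moreover have "indep_var (PiM A (\<lambda>_. borel)) (\<lambda>\<omega>. restrict (\<lambda>j. case_sum X C j \<omega>) A)
      (PiM B (\<lambda>_. borel)) (\<lambda>\<omega>. restrict (\<lambda>j. case_sum X C j \<omega>) B)"
    by (rule indep_var_restrict[OF indep]) (auto simp: A_def B_def)
  ultimately have "indep_var (borel \<Otimes>\<^sub>M borel) (hA \<circ> (\<lambda>\<omega>. restrict (\<lambda>j. case_sum X C j \<omega>) A))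
      (borel \<Otimes>\<^sub>M borel) (hB \<circ> (\<lambda>\<omega>. restrict (\<lambda>j. case_sum X C j \<omega>) B))"
    by (intro indep_var_compose)
  moreover have "hA (restrict (\<lambda>j. case_sum X C j \<omega>) A) = (elapsed X n \<omega>, post_age X C \<beta> \<tau> n \<omega>)" for \<omega>
    unfolding hA_def elapsed_def prod.inject
    by (intro conjI sum.cong post_age_cong) (auto simp: U_def V_def A_def)
  moreover have "hB (restrict (\<lambda>j. case_sum X C j \<omega>) B) = (X n \<omega>, C n \<omega>)" for \<omega>
    by (simp add: hB_def B_def)
  ultimately show ?thesis
    by (simp add: comp_def)
qed

lemma indep_gap_price: "indep_var borel (X n) borel (C n)"
proof -
  have "indep_var (PiM {Inl n} (\<lambda>_. borel)) (\<lambda>\<omega>. restrict (\<lambda>j. case_sum X C j \<omega>) {Inl n})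
      (PiM {Inr n} (\<lambda>_. borel)) (\<lambda>\<omega>. restrict (\<lambda>j. case_sum X C j \<omega>) {Inr n})"
    by (rule indep_var_restrict[OF indep]) auto
  then have "indep_var borel ((\<lambda>w. w (Inl n)) \<circ> (\<lambda>\<omega>. restrict (\<lambda>j. case_sum X C j \<omega>) {Inl n}))
      borel ((\<lambda>w. w (Inr n)) \<circ> (\<lambda>\<omega>. restrict (\<lambda>j. case_sum X C j \<omega>) {Inr n}))"
    by (rule indep_var_compose) (auto intro: measurable_component_singleton)
  then show ?thesis
    by (simp add: comp_def)
qed

lemma distr_gap_price: "distr M (borel \<Otimes>\<^sub>M borel) (\<lambda>\<omega>. (X n \<omega>, C n \<omega>)) = gap_law \<Otimes>\<^sub>M price_law"
  using indep_gap_price[of n] by (simp add: indep_var_distribution_eq distr_gap distr_price[of n])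

text \<open>Conditioning on the past in Fubini form: with the history frozen, gap and price are
  integrated against their laws, which are the same for all \<open>n\<close>.\<close>

lemma nn_integral_auction:
  assumes [measurable]: "\<beta> \<in> borel_measurable borel"
    and f: "(\<lambda>((e, p), (x, c)). f e p x c) \<in> borel_measurable ((borel \<Otimes>\<^sub>M borel) \<Otimes>\<^sub>M (borel \<Otimes>\<^sub>M borel))"
  shows "(\<integral>\<^sup>+\<omega>. f (elapsed X n \<omega>) (post_age X C \<beta> \<tau> n \<omega>) (X n \<omega>) (C n \<omega>) \<partial>M) =
    (\<integral>\<^sup>+\<omega>. (\<integral>\<^sup>+x. (\<integral>\<^sup>+c. f (elapsed X n \<omega>) (post_age X C \<beta> \<tau> n \<omega>) x c \<partial>price_law) \<partial>gap_law) \<partial>M)"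
proof -
  interpret P: prob_space price_law
    by (rule prob_space_price_law)
  interpret G: prob_space gap_law
    by (rule prob_space_gap_law)
  interpret GP: pair_prob_space gap_law price_law ..
  define H where "H \<omega> = (elapsed X n \<omega>, post_age X C \<beta> \<tau> n \<omega>)" for \<omega>
  define A where "A \<omega> = (X n \<omega>, C n \<omega>)" for \<omega>
  define g where "g = (\<lambda>((e, p), (x, c)). f e p x c)"
  have H [measurable]: "H \<in> M \<rightarrow>\<^sub>M borel \<Otimes>\<^sub>M borel"
    unfolding H_def by measurable
  have A [measurable]: "A \<in> M \<rightarrow>\<^sub>M borel \<Otimes>\<^sub>M borel"
    unfolding A_def by measurable
  have g [measurable]: "g \<in> borel_measurable ((borel \<Otimes>\<^sub>M borel) \<Otimes>\<^sub>M (borel \<Otimes>\<^sub>M borel))"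
    using f by (simp add: g_def)
  have [measurable_cong]: "sets (gap_law \<Otimes>\<^sub>M price_law) = sets (borel \<Otimes>\<^sub>M borel)"
    by (intro sets_pair_measure_cong) auto
  have "(\<integral>\<^sup>+\<omega>. g (H \<omega>, A \<omega>) \<partial>M) =
      integral\<^sup>N (distr M ((borel \<Otimes>\<^sub>M borel) \<Otimes>\<^sub>M (borel \<Otimes>\<^sub>M borel)) (\<lambda>\<omega>. (H \<omega>, A \<omega>))) g"
    by (subst nn_integral_distr) auto
  also have "distr M ((borel \<Otimes>\<^sub>M borel) \<Otimes>\<^sub>M (borel \<Otimes>\<^sub>M borel)) (\<lambda>\<omega>. (H \<omega>, A \<omega>)) =
      distr M (borel \<Otimes>\<^sub>M borel) H \<Otimes>\<^sub>M (gap_law \<Otimes>\<^sub>M price_law)"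
    using indep_history_auction[OF assms(1), of n \<tau>]
    unfolding indep_var_distribution_eq H_def A_def distr_gap_price by simp
  also have "integral\<^sup>N \<dots> g =
      (\<integral>\<^sup>+h. (\<integral>\<^sup>+a. g (h, a) \<partial>(gap_law \<Otimes>\<^sub>M price_law)) \<partial>distr M (borel \<Otimes>\<^sub>M borel) H)"
    by (rule GP.nn_integral_fst[symmetric]) measurable
  also have "\<dots> = (\<integral>\<^sup>+h. (\<integral>\<^sup>+x. (\<integral>\<^sup>+c. g (h, (x, c)) \<partial>price_law) \<partial>gap_law) \<partial>distr M (borel \<Otimes>\<^sub>M borel) H)"
    by (intro nn_integral_cong P.nn_integral_fst[symmetric]) measurable
  also have "\<dots> = (\<integral>\<^sup>+\<omega>. (\<integral>\<^sup>+x. (\<integral>\<^sup>+c. g (H \<omega>, (x, c)) \<partial>price_law) \<partial>gap_law) \<partial>M)"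
    by (subst nn_integral_distr) auto
  finally show ?thesis
    by (simp add: g_def H_def A_def)
qed

section \<open>The price distribution\<close>

lemma q_nonneg: "0 \<le> q x"
  using price_cdf[of 0 x] by (simp add: cdf_def flip: price_cdf[of 0 x])

lemma q_mono: "mono q"
proof -
  interpret P: real_distribution price_law
    by (rule real_distribution_distr) simp
  show ?thesis
    using P.cdf_nondecreasing by (auto intro!: monoI simp: price_cdf[of 0, symmetric])
qed

lemma q_le_1: "q x \<le> 1"
proof -
  interpret P: real_distribution price_law
    by (rule real_distribution_distr) simp
  show ?thesis
    using P.cdf_bounded_prob[of x] by (simp add: price_cdf)
qed

lemma q_neg: "x < 0 \<Longrightarrow> q x = 0"
proof -
  assume "x < 0"
  have "AE c in price_law. c \<notin> {..x}"
    using AE_price_law_nonneg by (rule eventually_mono) (use \<open>x < 0\<close> in auto)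
  then have "measure price_law {..x} = 0"
    by (subst measure_eq_AE[where B="{}"]) auto
  then show ?thesis
    by (simp add: price_cdf[of 0, symmetric] cdf_def)
qed

lemma measurable_q [measurable]: "q \<in> borel_measurable borel"
  by (rule borel_measurable_mono[OF q_mono])

text \<open>For \<open>v < 0\<close> the oriented integral is minus the integral over
  \<open>{v..0}\<close>. There \<open>q\<close> vanishes except possibly at 0, where the price may
  have an atom; a single point is negligible.\<close>

lemma price_primitive_nonpos: "v \<le> 0 \<Longrightarrow> price_primitive q v = 0"
proof -
  assume v: "v \<le> 0"
  have "(LBINT t:{v..0}. q t) = (LBINT t:{v..0}. 0)"
    unfolding set_lebesgue_integral_def
  proof (rule integral_cong_AE)
    have "AE t in lborel. t \<noteq> (0::real)"
      by (rule AE_lborel_singleton)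
    then show "AE t in lborel. indicator {v..0} t *\<^sub>R q t = indicator {v..0} t *\<^sub>R (0::real)"
      by eventually_elim (auto simp: indicator_def q_neg)
  qed auto
  with v show ?thesis
    unfolding price_primitive_def
    by (subst interval_integral_endpoints_reverse)
       (simp add: interval_integral_Icc set_lebesgue_integral_def)
qed

text \<open>Layer-cake formula: for \<open>c \<ge> 0\<close> the positive part of
  \<open>v - c\<close> is the length of the set of \<open>t\<close> in \<open>{0..v}\<close> with
  \<open>c \<le> t\<close>. Exchanging the integrals turns the probability of
  \<open>c \<le> t\<close> into \<open>q t\<close>.\<close>

lemma nn_integral_gain: "(\<integral>\<^sup>+c. ennreal (v - c) \<partial>price_law) = ennreal (price_primitive q v)"
proof (cases "v \<le> 0")
  case True
  have "(\<integral>\<^sup>+c. ennreal (v - c) \<partial>price_law) = (\<integral>\<^sup>+c. 0 \<partial>price_law)"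
    using AE_price_law_nonneg by (intro nn_integral_cong_AE) (use True in \<open>auto elim!: eventually_mono intro!: ennreal_neg\<close>)
  then show ?thesis
    by (simp add: price_primitive_nonpos True)
next
  case False
  interpret P: prob_space price_law
    by (rule prob_space_price_law)
  interpret PL: pair_sigma_finite price_law lborel ..
  have "(\<integral>\<^sup>+c. ennreal (v - c) \<partial>price_law) =
      (\<integral>\<^sup>+c. (\<integral>\<^sup>+t. indicator {0..v} t * indicator {(c, t). c \<le> t} (c, t) \<partial>lborel) \<partial>price_law)"
  proof (rule nn_integral_cong_AE)
    show "AE c in price_law. ennreal (v - c) =
        (\<integral>\<^sup>+t. indicator {0..v} t * indicator {(c, t). c \<le> t} (c, t) \<partial>lborel)"
      using AE_price_law_nonneg
    proof eventually_elim
      case (elim c)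
      have "(\<integral>\<^sup>+t. indicator {0..v} t * indicator {(c, t). c \<le> t} (c, t) \<partial>lborel) =
          (\<integral>\<^sup>+t. indicator {c..v} t \<partial>lborel)"
        using elim by (intro nn_integral_cong) (auto simp: indicator_def)
      also have "\<dots> = ennreal (v - c)"
        by (cases "c \<le> v") (auto simp: ennreal_neg)
      finally show ?case
        by simp
    qed
  qed
  also have "\<dots> = (\<integral>\<^sup>+t. (\<integral>\<^sup>+c. indicator {0..v} t * indicator {(c, t). c \<le> t} (c, t) \<partial>price_law) \<partial>lborel)"
    by (rule PL.Fubini'[symmetric]) measurable
  also have "\<dots> = (\<integral>\<^sup>+t. ennreal (indicator {0..v} t * q t) \<partial>lborel)"
  proof (intro nn_integral_cong)
    fix t :: real
    have "(\<integral>\<^sup>+c. indicator {0..v} t * indicator {(c, t). c \<le> t} (c, t) \<partial>price_law) =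
        indicator {0..v} t * (\<integral>\<^sup>+c. indicator {..t} c \<partial>price_law)"
      by (subst nn_integral_cmult[symmetric]) (auto intro!: nn_integral_cong simp: indicator_def)
    also have "(\<integral>\<^sup>+c. indicator {..t} c \<partial>price_law) = ennreal (q t)"
      by (simp add: price_cdf[of 0, symmetric] cdf_def P.emeasure_eq_measure)
    finally show "(\<integral>\<^sup>+c. indicator {0..v} t * indicator {(c, t). c \<le> t} (c, t) \<partial>price_law) =
        ennreal (indicator {0..v} t * q t)"
      by (simp add: indicator_def)
  qed
  also have "\<dots> = ennreal (\<integral>t. indicator {0..v} t * q t \<partial>lborel)"
  proof (rule nn_integral_eq_integral)
    show "integrable lborel (\<lambda>t. indicator {0..v} t * q t)"
      by (rule Bochner_Integration.integrable_bound[where f="indicator {0..v} :: real \<Rightarrow> real"])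
         (use False in \<open>auto simp: indicator_def q_le_1 q_nonneg intro!: integrable_real_indicator\<close>)
  qed (auto simp: indicator_def q_nonneg)
  also have "(\<integral>t. indicator {0..v} t * q t \<partial>lborel) = price_primitive q v"
    using False by (simp add: price_primitive_def interval_integral_Icc set_lebesgue_integral_def)
  finally show ?thesis .
qed

lemma price_primitive_nonneg: "0 \<le> price_primitive q v"
proof (cases "v \<le> 0")
  case False
  then show ?thesis
    by (simp add: price_primitive_def interval_integral_Icc set_lebesgue_integral_def q_nonneg)
qed (simp add: price_primitive_nonpos)

lemma price_primitive_mono: "u \<le> v \<Longrightarrow> price_primitive q u \<le> price_primitive q v"
proof -
  assume "u \<le> v"
  then have "ennreal (price_primitive q u) \<le> ennreal (price_primitive q v)"
    unfolding nn_integral_gain[symmetric] by (intro nn_integral_mono ennreal_leI) auto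
  then show ?thesis
    by (simp add: price_primitive_nonneg)
qed

text \<open>Raising the valuation by \<open>v - u\<close> raises the positive part of valuation
  minus price by at most that amount, whatever the price.\<close>

lemma price_primitive_diff_le:
  assumes "u \<le> v"
  shows "price_primitive q v \<le> price_primitive q u + (v - u)"
proof -
  interpret P: prob_space price_law
    by (rule prob_space_price_law)
  have "ennreal (price_primitive q v) \<le> (\<integral>\<^sup>+c. ennreal (u - c) + ennreal (v - u) \<partial>price_law)"
    unfolding nn_integral_gain[symmetric]
    by (intro nn_integral_mono) (use assms in \<open>auto simp: ennreal_plus_if\<close>)
  also have "\<dots> = ennreal (price_primitive q u) + ennreal (v - u)"
    by (subst nn_integral_add) (auto simp: nn_integral_gain P.emeasure_space_1[simplified])
  also have "\<dots> = ennreal (price_primitive q u + (v - u))"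
    using assms price_primitive_nonneg by simp
  finally show ?thesis
    using assms price_primitive_nonneg[of u] by (simp add: ennreal_le_iff del: ennreal_plus)
qed

lemma price_primitive_lipschitz: "\<bar>price_primitive q u - price_primitive q v\<bar> \<le> \<bar>u - v\<bar>"
  using price_primitive_diff_le[of u v] price_primitive_diff_le[of v u]
    price_primitive_mono[of u v] price_primitive_mono[of v u] by linarith

end

section \<open>Verification by sub- and supersolutions\<close>

text \<open>\<open>p\<close> plays the role of a signed payoff. Moving its negative part to the
  other side avoids subtraction in \<open>ennreal\<close>, so that sums of such inequalities stay
  meaningful even when losses are infinite.\<close>

lemma ennreal_parts_add_le:
  assumes "p + u \<le> w" "0 \<le> u" "0 \<le> w"
  shows "ennreal p + ennreal u \<le> ennreal (- p) + ennreal w"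
proof (cases "0 \<le> p")
  case True
  then have "ennreal p + ennreal u = ennreal (p + u)"
    using assms by simp
  also have "\<dots> \<le> ennreal w"
    by (intro ennreal_leI assms)
  also have "\<dots> \<le> ennreal (- p) + ennreal w"
    by simp
  finally show ?thesis .
next
  case False
  then have "ennreal p + ennreal u = ennreal u"
    by (simp add: ennreal_neg)
  also have "\<dots> \<le> ennreal (- p + w)"
    using assms by (intro ennreal_leI) auto
  also have "\<dots> = ennreal (- p) + ennreal w"
    using assms False by (intro ennreal_plus) auto
  finally show ?thesis .
qed

text \<open>Finiteness of \<open>a\<close> excludes \<open>\<infinity> - \<infinity>\<close>, while
  \<open>b\<close>, the total loss, may be infinite.\<close>

lemma enn2ereal_diff_le:
  assumes "a \<le> ennreal r + b" and "a < \<infinity>" and "0 \<le> r"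
  shows "enn2ereal a - enn2ereal b \<le> ereal r"
proof (cases b)
  case (real b')
  moreover from assms(2) obtain a' where "a = ennreal a'" "0 \<le> a'"
    by (cases a) auto
  ultimately show ?thesis
    using assms(1,3) by (simp add: enn2ereal_ennreal ennreal_plus[symmetric] del: ennreal_plus)
next
  case top
  with assms(2) show ?thesis
    by (cases a) (auto simp: enn2ereal_ennreal)
qed

lemma enn2ereal_diff_ge:
  assumes "ennreal r + b \<le> a" and "b < \<infinity>" and "0 \<le> r"
  shows "ereal r \<le> enn2ereal a - enn2ereal b"
proof -
  from assms(2) obtain b' where b: "b = ennreal b'" "0 \<le> b'"
    by (cases b) auto
  show ?thesis
  proof (cases a)
    case (real a')
    then show ?thesis
      using assms(1,3) b by (simp add: enn2ereal_ennreal ennreal_plus[symmetric] del: ennreal_plus)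
  next
    case top
    then show ?thesis
      using b by (simp add: enn2ereal_ennreal)
  qed
qed

text \<open>
  A model in which the value is monotone and bounded also at the (irrelevant) negative ages, so that
  it is measurable.
\<close>

locale monotone_auction_model = auction_model +
  assumes mono_value: "mono k" and bounded_value: "bounded (range k)"
begin

lemma measurable_value [measurable]: "k \<in> borel_measurable borel"
  by (rule borel_measurable_mono[OF mono_value])

lemma measurable_price_primitive [measurable]: "price_primitive q \<in> borel_measurable borel"
  by (rule borel_measurable_mono) (auto intro!: monoI price_primitive_mono)

lemma measurable_payoff [measurable (raw)]:
  assumes [measurable]: "\<beta> \<in> borel_measurable borel"
  shows "payoff X C k \<gamma> \<beta> \<tau> n \<in> borel_measurable M"
  unfolding payoff_def by measurable

section \<open>Expected gains and losses, and their discounting\<close>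

definition gains where "gains \<beta> \<tau> n = (\<integral>\<^sup>+\<omega>. ennreal (payoff X C k \<gamma> \<beta> \<tau> n \<omega>) \<partial>M)"
definition losses where "losses \<beta> \<tau> n = (\<integral>\<^sup>+\<omega>. ennreal (- payoff X C k \<gamma> \<beta> \<tau> n \<omega>) \<partial>M)"

lemma policy_value_eq:
  assumes [measurable]: "\<beta> \<in> borel_measurable borel"
  shows "policy_value M X C k \<gamma> \<beta> \<tau> = enn2ereal (\<Sum>n. gains \<beta> \<tau> n) - enn2ereal (\<Sum>n. losses \<beta> \<tau> n)"
  unfolding policy_value_def gains_def losses_def
  by (subst (1 2) nn_integral_suminf) auto

text \<open>Laplace transform at \<open>\<gamma>\<close> of a gap with rate \<open>\<mu>\<close>:
  the expected discount over one gap.\<close>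

definition discount_factor :: real where "discount_factor = \<mu> / (\<mu> + \<gamma>)"

lemma discount_factor: "0 < discount_factor" "discount_factor < 1"
  using intensity_pos discount_pos by (auto simp: discount_factor_def)

lemma nn_integral_gap_law:
  assumes [measurable]: "f \<in> borel_measurable borel"
  shows "(\<integral>\<^sup>+x. f x \<partial>gap_law) = (\<integral>\<^sup>+x. ennreal (\<mu> * exp (- \<mu> * x)) * f x * indicator {0..} x \<partial>lborel)"
  by (subst nn_integral_density)
     (auto intro!: nn_integral_cong simp: exponential_density_def indicator_def mult.commute)

lemma nn_integral_discount_gap: "(\<integral>\<^sup>+x. ennreal (exp (- (\<gamma> * x))) \<partial>gap_law) = ennreal discount_factor"
proof -
  interpret P: prob_space "density lborel (exponential_density (\<mu> + \<gamma>))"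
    using intensity_pos discount_pos by (intro prob_space_exponential_density) simp
  have "(\<integral>\<^sup>+x. ennreal (exp (- (\<gamma> * x))) \<partial>gap_law) =
      (\<integral>\<^sup>+x. ennreal discount_factor * ennreal (exponential_density (\<mu> + \<gamma>) x) \<partial>lborel)"
    using intensity_pos discount_pos
    by (subst nn_integral_density)
       (auto intro!: nn_integral_cong
          simp: exponential_density_def discount_factor_def ennreal_mult[symmetric] field_simps exp_add[symmetric])
  also have "\<dots> = ennreal discount_factor * (\<integral>\<^sup>+x. 1 \<partial>density lborel (exponential_density (\<mu> + \<gamma>)))"
    by (subst nn_integral_density) (auto simp: nn_integral_cmult)
  also have "(\<integral>\<^sup>+x. 1 \<partial>density lborel (exponential_density (\<mu> + \<gamma>))) = 1"
    using P.emeasure_space_1 by simp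
  finally show ?thesis
    by simp
qed

lemma nn_integral_discount_elapsed:
  "(\<integral>\<^sup>+\<omega>. ennreal (exp (- (\<gamma> * elapsed X n \<omega>))) \<partial>M) = ennreal (discount_factor ^ n)"
proof (induction n)
  case 0
  then show ?case
    by (simp add: emeasure_space_1)
next
  case (Suc n)
  interpret P: prob_space price_law
    by (rule prob_space_price_law)
  have "(\<integral>\<^sup>+\<omega>. ennreal (exp (- (\<gamma> * elapsed X (Suc n) \<omega>))) \<partial>M) =
      (\<integral>\<^sup>+\<omega>. ennreal (exp (- \<gamma> * (elapsed X n \<omega> + X n \<omega>))) \<partial>M)"
    by (simp add: elapsed_Suc)
  also have "\<dots> =
      (\<integral>\<^sup>+\<omega>. (\<integral>\<^sup>+x. (\<integral>\<^sup>+c. ennreal (exp (- \<gamma> * (elapsed X n \<omega> + x))) \<partial>price_law) \<partial>gap_law) \<partial>M)"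
    \<comment> \<open>The integrand ignores the age, so any policy and any initial age will
      do.\<close>
    by (rule nn_integral_auction[where f="\<lambda>e p x c. ennreal (exp (- \<gamma> * (e + x)))" and \<beta>="\<lambda>_. 0" and \<tau>=0])
       (simp, unfold split_beta, measurable)
  also have "\<dots> = (\<integral>\<^sup>+\<omega>. (\<integral>\<^sup>+x. ennreal (exp (- \<gamma> * elapsed X n \<omega>)) * ennreal (exp (- \<gamma> * x)) \<partial>gap_law) \<partial>M)"
    using P.emeasure_space_1
    by (intro nn_integral_cong) (simp add: ennreal_mult[symmetric] exp_add[symmetric] algebra_simps)
  also have "\<dots> = (\<integral>\<^sup>+\<omega>. ennreal (exp (- \<gamma> * elapsed X n \<omega>)) * ennreal discount_factor \<partial>M)"
    by (intro nn_integral_cong) (simp add: nn_integral_cmult nn_integral_discount_gap)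
  also have "\<dots> = ennreal (discount_factor ^ n) * ennreal discount_factor"
    by (simp add: nn_integral_multc Suc.IH)
  also have "\<dots> = ennreal (discount_factor ^ Suc n)"
    using discount_factor(1) by (simp add: ennreal_mult[symmetric] mult.commute)
  finally show ?case .
qed

lemma summable_bounded_discounted:
  assumes "\<And>n. f n \<le> ennreal B * ennreal (discount_factor ^ n)"
  shows "(\<Sum>n. f n) < \<infinity>"
proof -
  have "summable (\<lambda>n. max 0 B * discount_factor ^ n)"
    using discount_factor by (intro summable_mult summable_geometric) auto
  moreover have "f n \<le> ennreal (max 0 B * discount_factor ^ n)" for n
    using assms[of n] discount_factor by (simp add: ennreal_mult ennreal_max_0)
  ultimately have "(\<Sum>n. f n) \<le> (\<Sum>n. ennreal (max 0 B * discount_factor ^ n))"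
    by (intro suminf_le) auto
  also have "\<dots> = ennreal (\<Sum>n. max 0 B * discount_factor ^ n)"
    using \<open>summable _\<close> discount_factor by (intro suminf_ennreal_eq summable_sums) auto
  finally show ?thesis
    using ennreal_less_top order_le_less_trans by (metis infinity_ennreal_def)
qed

lemma nn_integral_payoff_le:
  assumes [measurable]: "g \<in> borel_measurable M"
    and "AE \<omega> in M. g \<omega> \<le> exp (- \<gamma> * arrival X n \<omega>) * B"
  shows "(\<integral>\<^sup>+\<omega>. ennreal (g \<omega>) \<partial>M) \<le> ennreal B * ennreal (discount_factor ^ n)"
proof -
  have "(\<integral>\<^sup>+\<omega>. ennreal (g \<omega>) \<partial>M) \<le> (\<integral>\<^sup>+\<omega>. ennreal B * ennreal (exp (- \<gamma> * elapsed X (Suc n) \<omega>)) \<partial>M)"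
    using assms(2)
    by (intro nn_integral_mono_AE)
       (auto elim!: eventually_mono simp: ennreal_mult''[symmetric] arrival_eq_elapsed elapsed_Suc mult.commute
         intro!: ennreal_leI)
  also have "\<dots> = ennreal B * ennreal (discount_factor ^ Suc n)"
    by (simp add: nn_integral_cmult nn_integral_discount_elapsed del: power_Suc)
  \<comment> \<open>The time of auction \<open>n\<close> is a sum of \<open>n + 1\<close> gaps; the
    surplus factor is at most 1 and is dropped.\<close>
  also have "\<dots> \<le> ennreal B * ennreal (discount_factor ^ n)"
    using discount_factor by (intro mult_left_mono ennreal_leI power_decreasing) auto
  finally show ?thesis .
qed

text \<open>With non-negative prices a payoff never exceeds the discounted bound of
  \<open>k\<close>, however high the bid. This keeps \<open>\<infinity> - \<infinity>\<close> out of
  \<open>policy_value\<close>.\<close>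

lemma suminf_gains_finite:
  assumes [measurable]: "\<beta> \<in> borel_measurable borel"
  shows "(\<Sum>n. gains \<beta> \<tau> n) < \<infinity>"
proof -
  obtain K where K: "\<And>t. \<bar>k t\<bar> \<le> K"
    using bounded_value by (auto simp: bounded_iff)
  then have "0 \<le> K"
    using abs_ge_zero order_trans by blast
  show ?thesis
  proof (rule summable_bounded_discounted)
    fix n
    show "gains \<beta> \<tau> n \<le> ennreal K * ennreal (discount_factor ^ n)"
      unfolding gains_def
    proof (rule nn_integral_payoff_le)
      show "AE \<omega> in M. payoff X C k \<gamma> \<beta> \<tau> n \<omega> \<le> exp (- \<gamma> * arrival X n \<omega>) * K"
        using price_nonneg[of n]
      proof eventually_elim
        case (elim \<omega>)
        have "(k (age X C \<beta> \<tau> n \<omega>) - C n \<omega>) * of_bool (\<beta> (age X C \<beta> \<tau> n \<omega>) > C n \<omega>) \<le> K"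
          using K[of "age X C \<beta> \<tau> n \<omega>"] elim \<open>0 \<le> K\<close> by (auto simp: of_bool_def)
        then show ?case
          unfolding payoff_def mult.assoc by (intro mult_left_mono) auto
      qed
    qed measurable
  qed
qed

text \<open>The one-auction Bellman operator at the age \<open>a\<close> reached after the previous
  auction: \<open>y\<close> is the continuation value after a loss, \<open>y 0\<close> after a win.
  The price is already integrated out, which is where \<open>price_primitive\<close> comes
  from.\<close>

definition bellman :: "(real \<Rightarrow> real) \<Rightarrow> real \<Rightarrow> ennreal" where
  "bellman y a =
     (\<integral>\<^sup>+x. ennreal (exp (- \<gamma> * x) * (y (a + x) + price_primitive q (k (a + x) + y 0 - y (a + x)))) \<partial>gap_law)"

definition remainder where
  "remainder y \<beta> \<tau> n = (\<integral>\<^sup>+\<omega>. ennreal (exp (- \<gamma> * elapsed X n \<omega>) * y (post_age X C \<beta> \<tau> n \<omega>)) \<partial>M)"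

text \<open>The auctions before \<open>n\<close> are played by \<open>\<beta>\<close>, whereas
  auction \<open>n\<close> is won exactly when this pays off, as if the price were known;
  \<open>y\<close> is the value of what follows.\<close>

definition best_response where
  "best_response y \<beta> \<tau> n = (\<integral>\<^sup>+\<omega>. ennreal (exp (- \<gamma> * arrival X n \<omega>) *
     (y (age X C \<beta> \<tau> n \<omega>) + max 0 (k (age X C \<beta> \<tau> n \<omega>) + y 0 - y (age X C \<beta> \<tau> n \<omega>) - C n \<omega>))) \<partial>M)"

lemma best_response_eq:
  assumes [measurable]: "\<beta> \<in> borel_measurable borel" "y \<in> borel_measurable borel" and y: "\<And>t. 0 \<le> y t"
  shows "best_response y \<beta> \<tau> n =
    (\<integral>\<^sup>+\<omega>. ennreal (exp (- \<gamma> * elapsed X n \<omega>)) * bellman y (post_age X C \<beta> \<tau> n \<omega>) \<partial>M)"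
proof -
  interpret P: prob_space price_law
    by (rule prob_space_price_law)
  define f where "f e p x c = ennreal (exp (- \<gamma> * (e + x)) *
     (y (p + x) + max 0 (k (p + x) + y 0 - y (p + x) - c)))" for e p x c
  have "best_response y \<beta> \<tau> n =
      (\<integral>\<^sup>+\<omega>. f (elapsed X n \<omega>) (post_age X C \<beta> \<tau> n \<omega>) (X n \<omega>) (C n \<omega>) \<partial>M)"
    by (simp add: best_response_def f_def arrival_eq_elapsed age_eq_post_age)
  also have "\<dots> = (\<integral>\<^sup>+\<omega>. (\<integral>\<^sup>+x. (\<integral>\<^sup>+c. f (elapsed X n \<omega>) (post_age X C \<beta> \<tau> n \<omega>) x c \<partial>price_law) \<partial>gap_law) \<partial>M)"
    by (rule nn_integral_auction) (simp, unfold f_def split_beta, measurable)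
  also have "\<dots> = (\<integral>\<^sup>+\<omega>. (\<integral>\<^sup>+x. ennreal (exp (- \<gamma> * elapsed X n \<omega>)) *
      ennreal (exp (- \<gamma> * x) * (y (post_age X C \<beta> \<tau> n \<omega> + x) +
        price_primitive q (k (post_age X C \<beta> \<tau> n \<omega> + x) + y 0 - y (post_age X C \<beta> \<tau> n \<omega> + x)))) \<partial>gap_law) \<partial>M)"
  proof (intro nn_integral_cong)
    fix \<omega> x
    define e where "e = elapsed X n \<omega>"
    define s where "s = post_age X C \<beta> \<tau> n \<omega> + x"
    have "(\<integral>\<^sup>+c. f e (post_age X C \<beta> \<tau> n \<omega>) x c \<partial>price_law) =
        (\<integral>\<^sup>+c. ennreal (exp (- \<gamma> * (e + x))) * (ennreal (y s) + ennreal (k s + y 0 - y s - c)) \<partial>price_law)"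
      by (intro nn_integral_cong) (simp add: f_def s_def y ennreal_mult ennreal_max_0)
    also have "\<dots> = ennreal (exp (- \<gamma> * (e + x))) * (ennreal (y s) + ennreal (price_primitive q (k s + y 0 - y s)))"
      using P.emeasure_space_1 by (simp add: nn_integral_cmult nn_integral_add nn_integral_gain)
    also have "\<dots> = ennreal (exp (- \<gamma> * e)) *
        ennreal (exp (- \<gamma> * x) * (y s + price_primitive q (k s + y 0 - y s)))"
      by (simp add: y price_primitive_nonneg ennreal_mult[symmetric] ennreal_plus[symmetric] exp_add[symmetric]
          algebra_simps del: ennreal_plus)
    finally show "(\<integral>\<^sup>+c. f (elapsed X n \<omega>) (post_age X C \<beta> \<tau> n \<omega>) x c \<partial>price_law) =
        ennreal (exp (- \<gamma> * elapsed X n \<omega>)) *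
        ennreal (exp (- \<gamma> * x) * (y (post_age X C \<beta> \<tau> n \<omega> + x) +
        price_primitive q (k (post_age X C \<beta> \<tau> n \<omega> + x) + y 0 - y (post_age X C \<beta> \<tau> n \<omega> + x))))"
      by (simp add: e_def s_def)
  qed
  also have "\<dots> = (\<integral>\<^sup>+\<omega>. ennreal (exp (- \<gamma> * elapsed X n \<omega>)) * bellman y (post_age X C \<beta> \<tau> n \<omega>) \<partial>M)"
    unfolding bellman_def by (intro nn_integral_cong nn_integral_cmult) measurable
  finally show ?thesis .
qed

lemma best_response_le_remainder:
  assumes "\<beta> \<in> borel_measurable borel" "y \<in> borel_measurable borel" and y: "\<And>t. 0 \<le> y t"
    and "0 \<le> \<tau>" and super: "\<And>a. 0 \<le> a \<Longrightarrow> bellman y a \<le> ennreal (y a)"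
  shows "best_response y \<beta> \<tau> n \<le> remainder y \<beta> \<tau> n"
  unfolding best_response_eq[OF assms(1-3)] remainder_def
  using AE_history_nonneg[OF \<open>0 \<le> \<tau>\<close>, of \<beta>]
  by (intro nn_integral_mono_AE) (auto elim!: eventually_mono intro!: mult_left_mono super simp: ennreal_mult y)

lemma remainder_le_best_response:
  assumes "\<beta> \<in> borel_measurable borel" "y \<in> borel_measurable borel" and y: "\<And>t. 0 \<le> y t"
    and "0 \<le> \<tau>" and sub: "\<And>a. 0 \<le> a \<Longrightarrow> ennreal (y a) \<le> bellman y a"
  shows "remainder y \<beta> \<tau> n \<le> best_response y \<beta> \<tau> n"
  unfolding best_response_eq[OF assms(1-3)] remainder_def
  using AE_history_nonneg[OF \<open>0 \<le> \<tau>\<close>, of \<beta>]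
  by (intro nn_integral_mono_AE) (auto elim!: eventually_mono intro!: mult_left_mono sub simp: ennreal_mult y)

text \<open>Pathwise, before discounting, a win is worth \<open>k s - C n \<omega> + y 0\<close> and
  a loss \<open>y s\<close>; the best response takes the larger of the two.\<close>

lemma gains_remainder_le:
  assumes [measurable]: "\<beta> \<in> borel_measurable borel" "y \<in> borel_measurable borel" and y: "\<And>t. 0 \<le> y t"
  shows "gains \<beta> \<tau> n + remainder y \<beta> \<tau> (Suc n) \<le> losses \<beta> \<tau> n + best_response y \<beta> \<tau> n"
  unfolding gains_def remainder_def losses_def best_response_def
proof (subst (1 2) nn_integral_add[symmetric], goal_cases)
  case 5
  show ?case
  proof (intro nn_integral_mono ennreal_parts_add_le)
    fix \<omega>
    define s where "s = age X C \<beta> \<tau> n \<omega>"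
    define d where "d = exp (- \<gamma> * arrival X n \<omega>)"
    have d: "exp (- \<gamma> * elapsed X (Suc n) \<omega>) = d" "0 \<le> d"
      by (simp_all add: d_def arrival_eq_elapsed elapsed_Suc)
    have "(k s - C n \<omega>) * of_bool (\<beta> s > C n \<omega>) + y (post_age X C \<beta> \<tau> (Suc n) \<omega>)
        \<le> y s + max 0 (k s + y 0 - y s - C n \<omega>)"
      by (simp add: post_age_Suc max_def flip: s_def)
    from mult_left_mono[OF this d(2)]
    show "payoff X C k \<gamma> \<beta> \<tau> n \<omega> + exp (- \<gamma> * elapsed X (Suc n) \<omega>) * y (post_age X C \<beta> \<tau> (Suc n) \<omega>) \<le>
        exp (- \<gamma> * arrival X n \<omega>) * (y (age X C \<beta> \<tau> n \<omega>) +
          max 0 (k (age X C \<beta> \<tau> n \<omega>) + y 0 - y (age X C \<beta> \<tau> n \<omega>) - C n \<omega>))"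
      unfolding payoff_def d(1) s_def[symmetric] d_def[symmetric] by (simp add: algebra_simps)
  qed (simp_all add: y)
qed measurable

text \<open>In a second-price auction one bids the true worth of winning: the item plus a restart at
  age 0, minus the forgone continuation value. Truncation at 0 makes this a policy; at non-negative
  prices a bid of 0 never wins, because winning requires a strictly higher bid.\<close>

definition greedy_policy :: "(real \<Rightarrow> real) \<Rightarrow> real \<Rightarrow> real" where
  "greedy_policy y s = max 0 (k s + y 0 - y s)"

text \<open>Prices are almost surely non-negative, so truncating the bid changes no outcome: the
  greedy bid wins exactly when the best response has a positive gain.\<close>

lemma losses_best_response_le:
  fixes y
  defines "\<beta> \<equiv> greedy_policy y"
  assumes [measurable]: "y \<in> borel_measurable borel" and y: "\<And>t. 0 \<le> y t"
  shows "losses \<beta> \<tau> n + best_response y \<beta> \<tau> n \<le> gains \<beta> \<tau> n + remainder y \<beta> \<tau> (Suc n)"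
proof -
  have [measurable]: "\<beta> \<in> borel_measurable borel"
    unfolding \<beta>_def greedy_policy_def by measurable
  show ?thesis
    unfolding gains_def remainder_def losses_def best_response_def
  proof (subst (1 2) nn_integral_add[symmetric], goal_cases)
    case 5
    show ?case
    proof (rule nn_integral_mono_AE, use price_nonneg[of n] in eventually_elim)
      case (elim \<omega>)
      define s where "s = age X C \<beta> \<tau> n \<omega>"
      define d where "d = exp (- \<gamma> * arrival X n \<omega>)"
      have d: "exp (- \<gamma> * elapsed X (Suc n) \<omega>) = d" "0 \<le> d"
        by (simp_all add: d_def arrival_eq_elapsed elapsed_Suc)
      have "- ((k s - C n \<omega>) * of_bool (\<beta> s > C n \<omega>)) + (y s + max 0 (k s + y 0 - y s - C n \<omega>))
          \<le> y (post_age X C \<beta> \<tau> (Suc n) \<omega>)"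
      proof -
        have "\<beta> s = max 0 (k s + y 0 - y s)"
          by (simp add: \<beta>_def greedy_policy_def)
        with elim show ?thesis
          by (simp add: post_age_Suc max_def flip: s_def)
      qed
      from mult_left_mono[OF this d(2)]
      have "- payoff X C k \<gamma> \<beta> \<tau> n \<omega> + d * (y s + max 0 (k s + y 0 - y s - C n \<omega>)) \<le>
          d * y (post_age X C \<beta> \<tau> (Suc n) \<omega>)"
        unfolding payoff_def s_def[symmetric] d_def[symmetric] by (simp add: algebra_simps)
      \<comment> \<open>Applied to the negated payoff, so gains and losses exchange their
        roles.\<close>
      from ennreal_parts_add_le[OF this] show ?case
        unfolding d(1) s_def[symmetric] d_def[symmetric] using d(2) y by simp
    qed
  qed measurable
qed

text \<open>The one-auction inequality telescopes, starting from the remainder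
  \<open>y \<tau>\<close> before any auction. The remainder after \<open>n\<close> auctions is
  non-negative and is dropped before \<open>n\<close> tends to infinity.\<close>

lemma policy_value_le_supersolution:
  assumes [measurable]: "\<beta> \<in> borel_measurable borel" "y \<in> borel_measurable borel"
    and y: "\<And>t. 0 \<le> y t" and "0 \<le> \<tau>"
    and super: "\<And>a. 0 \<le> a \<Longrightarrow> bellman y a \<le> ennreal (y a)"
  shows "policy_value M X C k \<gamma> \<beta> \<tau> \<le> ereal (y \<tau>)"
proof -
  have partial: "(\<Sum>i<n. gains \<beta> \<tau> i) + remainder y \<beta> \<tau> n \<le> ennreal (y \<tau>) + (\<Sum>i<n. losses \<beta> \<tau> i)" for n
  proof (induction n)
    case 0
    show ?case
      by (simp add: remainder_def emeasure_space_1)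
  next
    case (Suc n)
    have "gains \<beta> \<tau> n + remainder y \<beta> \<tau> (Suc n) \<le> losses \<beta> \<tau> n + remainder y \<beta> \<tau> n"
      using gains_remainder_le[of \<beta> y \<tau> n] best_response_le_remainder[of \<beta> y \<tau> n] assms
      by (meson add_left_mono order_trans)
    then have "(\<Sum>i<n. gains \<beta> \<tau> i) + (gains \<beta> \<tau> n + remainder y \<beta> \<tau> (Suc n)) \<le>
        losses \<beta> \<tau> n + ((\<Sum>i<n. gains \<beta> \<tau> i) + remainder y \<beta> \<tau> n)"
      by (metis add_left_mono add.left_commute)
    also have "\<dots> \<le> losses \<beta> \<tau> n + (ennreal (y \<tau>) + (\<Sum>i<n. losses \<beta> \<tau> i))"
      by (intro add_left_mono Suc.IH)
    finally show ?case
      by (simp add: ac_simps)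
  qed
  have "(\<Sum>i<n. gains \<beta> \<tau> i) \<le> ennreal (y \<tau>) + (\<Sum>i. losses \<beta> \<tau> i)" for n
  proof -
    have "(\<Sum>i<n. gains \<beta> \<tau> i) \<le> (\<Sum>i<n. gains \<beta> \<tau> i) + remainder y \<beta> \<tau> n"
      by simp
    also note partial[of n]
    also have "ennreal (y \<tau>) + (\<Sum>i<n. losses \<beta> \<tau> i) \<le> ennreal (y \<tau>) + (\<Sum>i. losses \<beta> \<tau> i)"
      by (intro add_left_mono sum_le_suminf) auto
    finally show ?thesis .
  qed
  then have "(\<Sum>i. gains \<beta> \<tau> i) \<le> ennreal (y \<tau>) + (\<Sum>i. losses \<beta> \<tau> i)"
    by (intro suminf_le_const) auto
  then show ?thesis
    unfolding policy_value_eq[OF assms(1)]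
    by (intro enn2ereal_diff_le suminf_gains_finite assms)
qed

text \<open>For the greedy policy the telescoped inequality is reversed. The remainder is now on the
  larger side and has to disappear: it is at most \<open>B\<close> times the expected discount after
  \<open>n\<close> gaps.\<close>

lemma policy_value_ge_subsolution:
  assumes [measurable]: "y \<in> borel_measurable borel"
    and y: "\<And>t. 0 \<le> y t" "\<And>t. y t \<le> B" and "0 \<le> \<tau>"
    and sub: "\<And>a. 0 \<le> a \<Longrightarrow> ennreal (y a) \<le> bellman y a"
  shows "ereal (y \<tau>) \<le> policy_value M X C k \<gamma> (greedy_policy y) \<tau>"
proof -
  define \<beta> where "\<beta> = greedy_policy y"
  have [measurable]: "\<beta> \<in> borel_measurable borel"
    unfolding \<beta>_def greedy_policy_def by measurable
  have partial: "ennreal (y \<tau>) + (\<Sum>i<n. losses \<beta> \<tau> i) \<le> (\<Sum>i<n. gains \<beta> \<tau> i) + remainder y \<beta> \<tau> n" for n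
  proof (induction n)
    case 0
    show ?case
      by (simp add: remainder_def emeasure_space_1)
  next
    case (Suc n)
    have "losses \<beta> \<tau> n + remainder y \<beta> \<tau> n \<le> gains \<beta> \<tau> n + remainder y \<beta> \<tau> (Suc n)"
      using losses_best_response_le[of y \<tau> n] remainder_le_best_response[of \<beta> y \<tau> n] assms
      by (simp flip: \<beta>_def) (meson add_left_mono order_trans)
    have "losses \<beta> \<tau> n + (ennreal (y \<tau>) + (\<Sum>i<n. losses \<beta> \<tau> i)) \<le>
        losses \<beta> \<tau> n + ((\<Sum>i<n. gains \<beta> \<tau> i) + remainder y \<beta> \<tau> n)"
      by (intro add_left_mono Suc.IH)
    also have "\<dots> \<le> (\<Sum>i<n. gains \<beta> \<tau> i) + (gains \<beta> \<tau> n + remainder y \<beta> \<tau> (Suc n))"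
      using \<open>losses \<beta> \<tau> n + remainder y \<beta> \<tau> n \<le> _\<close> by (metis add_left_mono add.left_commute)
    finally show ?case
      by (simp add: ac_simps)
  qed
  have remainder_le: "remainder y \<beta> \<tau> n \<le> ennreal B * ennreal (discount_factor ^ n)" for n
  proof -
    have "remainder y \<beta> \<tau> n \<le> (\<integral>\<^sup>+\<omega>. ennreal B * ennreal (exp (- \<gamma> * elapsed X n \<omega>)) \<partial>M)"
      unfolding remainder_def
      by (intro nn_integral_mono) (auto simp: ennreal_mult''[symmetric] mult.commute intro!: ennreal_leI mult_left_mono y)
    then show ?thesis
      by (simp add: nn_integral_cmult nn_integral_discount_elapsed)
  qed
  have "(\<lambda>n. ennreal B * ennreal (discount_factor ^ n)) \<longlonglongrightarrow> ennreal B * ennreal 0"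
    using discount_factor
    by (intro ennreal_tendsto_cmult tendsto_ennrealI LIMSEQ_power_zero) auto
  then have lim: "(\<lambda>n. (\<Sum>i. gains \<beta> \<tau> i) + ennreal B * ennreal (discount_factor ^ n)) \<longlonglongrightarrow> (\<Sum>i. gains \<beta> \<tau> i) + 0"
    by (intro tendsto_add tendsto_const) simp
  \<comment> \<open>The number \<open>m\<close> of counted losses is held fixed while
    \<open>n\<close> tends to infinity and removes the remainder; only then does \<open>m\<close>
    grow.\<close>
  have "ennreal (y \<tau>) + (\<Sum>i<m. losses \<beta> \<tau> i) \<le> (\<Sum>i. gains \<beta> \<tau> i)" for m
  proof -
    have "ennreal (y \<tau>) + (\<Sum>i<m. losses \<beta> \<tau> i) \<le>
        (\<Sum>i. gains \<beta> \<tau> i) + ennreal B * ennreal (discount_factor ^ n)" if "m \<le> n" for n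
    proof -
      have "ennreal (y \<tau>) + (\<Sum>i<m. losses \<beta> \<tau> i) \<le> ennreal (y \<tau>) + (\<Sum>i<n. losses \<beta> \<tau> i)"
        using that by (intro add_left_mono sum_mono2) auto
      also note partial[of n]
      also have "(\<Sum>i<n. gains \<beta> \<tau> i) + remainder y \<beta> \<tau> n \<le>
          (\<Sum>i. gains \<beta> \<tau> i) + ennreal B * ennreal (discount_factor ^ n)"
        by (intro add_mono remainder_le sum_le_suminf) auto
      finally show ?thesis .
    qed
    then show ?thesis
      using LIMSEQ_le_const[OF lim] by auto
  qed
  then have "(\<lambda>m. ennreal (y \<tau>) + (\<Sum>i<m. losses \<beta> \<tau> i)) \<longlonglongrightarrow> ennreal (y \<tau>) + (\<Sum>i. losses \<beta> \<tau> i) \<Longrightarrow>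
      ennreal (y \<tau>) + (\<Sum>i. losses \<beta> \<tau> i) \<le> (\<Sum>i. gains \<beta> \<tau> i)"
    by (intro LIMSEQ_le_const2) auto
  moreover have "(\<lambda>m. ennreal (y \<tau>) + (\<Sum>i<m. losses \<beta> \<tau> i)) \<longlonglongrightarrow> ennreal (y \<tau>) + (\<Sum>i. losses \<beta> \<tau> i)"
    by (intro tendsto_add tendsto_const summable_LIMSEQ) auto
  ultimately have le: "ennreal (y \<tau>) + (\<Sum>i. losses \<beta> \<tau> i) \<le> (\<Sum>i. gains \<beta> \<tau> i)"
    by simp
  \<comment> \<open>Losses can be infinite for a general policy, but for this one the finite gains
    dominate them.\<close>
  have "(\<Sum>i. losses \<beta> \<tau> i) < \<infinity>"
    using le suminf_gains_finite[of \<beta> \<tau>] by (auto simp: less_top[symmetric] top_unique)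
  with le show ?thesis
    unfolding \<beta>_def[symmetric] by (subst policy_value_eq) (auto intro!: enn2ereal_diff_ge y)
qed

lemma bellman_eq:
  assumes [measurable]: "y \<in> borel_measurable borel" and "\<And>t. 0 \<le> y t"
  shows "bellman y a = (\<integral>\<^sup>+x. ennreal (\<mu> * exp (- (\<mu> + \<gamma>) * x) *
    (y (a + x) + price_primitive q (k (a + x) + y 0 - y (a + x)))) * indicator {0..} x \<partial>lborel)"
proof -
  define U where "U x = y (a + x) + price_primitive q (k (a + x) + y 0 - y (a + x))" for x
  have "ennreal (\<mu> * exp (- \<mu> * x)) * ennreal (exp (- \<gamma> * x) * U x) = ennreal (\<mu> * exp (- (\<mu> + \<gamma>) * x) * U x)" for x
  proof -
    have "exp (- (\<mu> + \<gamma>) * x) = exp (- \<mu> * x) * exp (- \<gamma> * x)"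
      by (simp add: exp_add[symmetric] algebra_simps)
    then show ?thesis
      using intensity_pos by (simp add: ennreal_mult'[symmetric] mult_ac)
  qed
  then show ?thesis
    unfolding bellman_def U_def by (subst nn_integral_gap_law) simp_all
qed

end

section \<open>Solutions of the Cauchy problem and the optimal value\<close>

context monotone_auction_model
begin

lemma isCont_price_primitive: "isCont (price_primitive q) v"
proof -
  have "1-lipschitz_on UNIV (price_primitive q)"
    using price_primitive_lipschitz by (auto intro!: lipschitz_onI simp: dist_real_def)
  then show ?thesis
    using lipschitz_on_continuous_on continuous_on_eq_continuous_at open_UNIV by blast
qed

lemma price_primitive_le_abs: "price_primitive q v \<le> \<bar>v\<bar>"
  using price_primitive_lipschitz[of v 0] price_primitive_nonpos[of 0] by simp

lemma Phi_lipschitz: "\<bar>Phi q k \<mu> \<gamma> t y l - Phi q k \<mu> \<gamma> t z l\<bar> \<le> (\<gamma> + \<mu>) * \<bar>y - z\<bar>"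
proof -
  define d where "d = price_primitive q (k t + l - y) - price_primitive q (k t + l - z)"
  have "\<bar>d\<bar> \<le> \<bar>y - z\<bar>"
    using price_primitive_lipschitz[of "k t + l - y" "k t + l - z"] by (simp add: d_def)
  have "Phi q k \<mu> \<gamma> t y l - Phi q k \<mu> \<gamma> t z l = \<gamma> * (y - z) - \<mu> * d"
    by (simp add: Phi_def d_def algebra_simps)
  also have "\<bar>\<dots>\<bar> \<le> \<gamma> * \<bar>y - z\<bar> + \<mu> * \<bar>d\<bar>"
    using intensity_pos discount_pos abs_triangle_ineq4[of "\<gamma> * (y - z)" "\<mu> * d"] by (simp add: abs_mult)
  also have "\<dots> \<le> \<gamma> * \<bar>y - z\<bar> + \<mu> * \<bar>y - z\<bar>"
    using \<open>\<bar>d\<bar> \<le> _\<close> intensity_pos by simp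
  finally show ?thesis
    by (simp add: distrib_right)
qed

definition jumps :: "real set" where "jumps = {t. \<not> isCont k t}"

lemma countable_jumps: "countable jumps"
  unfolding jumps_def by (rule mono_ctble_discont[OF mono_value])

lemma continuous_price_primitive_compose:
  "continuous (at t within A) f \<Longrightarrow> continuous (at t within A) (\<lambda>s. price_primitive q (f s))"
  by (rule continuous_within_compose3[OF isCont_price_primitive])

lemma continuous_value: "t \<notin> jumps \<Longrightarrow> continuous (at t within A) k"
  by (simp add: jumps_def continuous_at_imp_continuous_at_within)

text \<open>\<open>Phi\<close> is defined and Lipschitz with constant
  \<open>\<gamma> + \<mu>\<close> for negative second arguments as well, so this solution may leave
  the domain \<open>[0,\<infinity>)\<close>. Only the jumps of \<open>k\<close> obstruct
  differentiability.\<close>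

lemma global_solution:
  obtains Y where "Y 0 = y0" "continuous_on {0..} Y"
    "\<And>t. 0 \<le> t \<Longrightarrow> t \<notin> jumps \<Longrightarrow> (Y has_real_derivative Phi q k \<mu> \<gamma> t (Y t) l) (at t within {0..})"
proof -
  obtain K where K: "\<And>t. \<bar>k t\<bar> \<le> K"
    using bounded_value by (auto simp: bounded_iff)
  show ?thesis
  proof (rule global_cauchy_solution_exists[of "\<gamma> + \<mu>" "\<lambda>t y. Phi q k \<mu> \<gamma> t y l" "\<mu> * (K + \<bar>l\<bar>)" jumps y0])
    show "\<bar>Phi q k \<mu> \<gamma> t 0 l\<bar> \<le> \<mu> * (K + \<bar>l\<bar>)" for t
      using K[of t] price_primitive_le_abs[of "k t + l"] price_primitive_nonneg[of "k t + l"] intensity_pos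
      by (simp add: Phi_def abs_mult)
    show "(\<lambda>t. Phi q k \<mu> \<gamma> t (Y t) l) \<in> borel_measurable borel" if "Y \<in> borel_measurable borel" for Y
      using that unfolding Phi_def by measurable
    show "continuous (at t within {0..}) (\<lambda>s. Phi q k \<mu> \<gamma> s (Y s) l)"
      if "t \<notin> jumps" "continuous (at t within {0..}) Y" for t Y
      unfolding Phi_def
      by (intro continuous_intros continuous_price_primitive_compose continuous_value that)
  qed (use Phi_lipschitz intensity_pos discount_pos that in auto)
qed

lemma Z_eq:
  assumes "0 \<le> y0" and "Y 0 = y0" and "continuous_on {0..} Y"
    and "\<And>t. 0 \<le> t \<Longrightarrow> t \<notin> jumps \<Longrightarrow> (Y has_real_derivative Phi q k \<mu> \<gamma> t (Y t) l) (at t within {0..})"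
  defines "J \<equiv> {t. 0 \<le> t \<and> (\<forall>s\<in>{0..t}. 0 \<le> Y s)}"
  shows "Z q k \<mu> \<gamma> y0 l = (J, restrict Y J)"
proof -
  have "maximal_solution (\<lambda>t y. Phi q k \<mu> \<gamma> t y l) y0 I V \<longleftrightarrow> I = J \<and> V = restrict Y J" for I V
    unfolding J_def by (rule maximal_solution_iff[OF Phi_lipschitz assms(1-3) countable_jumps assms(4)])
  then show ?thesis
    unfolding Z_def by (intro the_equality) auto
qed

section \<open>Bellman inequalities from differential inequalities\<close>

context
  fixes y D :: "real \<Rightarrow> real" and S :: "real set"
  assumes y_cont: "continuous_on UNIV y" and y_nonneg: "\<And>t. 0 \<le> y t"
    and S: "countable S" "jumps \<subseteq> S"
    and y_deriv: "\<And>t. 0 \<le> t \<Longrightarrow> t \<notin> S \<Longrightarrow> (y has_real_derivative D t) (at t within {0..})"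
begin

lemma measurable_y [measurable]: "y \<in> borel_measurable borel"
  by (rule borel_measurable_continuous_onI[OF y_cont])

definition bellman_integrand where
  "bellman_integrand a x = \<mu> * exp (- (\<mu> + \<gamma>) * x) *
    (y (a + x) + price_primitive q (k (a + x) + y 0 - y (a + x)))"

definition discounted where "discounted a x = - (exp (- (\<mu> + \<gamma>) * x) * y (a + x))"

lemma bellman_eq_integrand: "bellman y a = (\<integral>\<^sup>+x. ennreal (bellman_integrand a x) * indicator {0..} x \<partial>lborel)"
  unfolding bellman_integrand_def by (rule bellman_eq) (auto intro: y_nonneg)

lemma bellman_integrand_nonneg: "0 \<le> bellman_integrand a x"
  using intensity_pos by (auto simp: bellman_integrand_def intro!: mult_nonneg_nonneg add_nonneg_nonneg y_nonneg price_primitive_nonneg)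

lemma measurable_bellman_integrand [measurable]: "bellman_integrand a \<in> borel_measurable borel"
  unfolding bellman_integrand_def by measurable

lemma continuous_bellman_integrand:
  assumes "a + x \<notin> S"
  shows "continuous (at x within A) (bellman_integrand a)"
proof -
  have "isCont y (a + x)"
    using y_cont by (simp add: continuous_on_eq_continuous_at)
  then have 1: "continuous (at x within A) (\<lambda>x. y (a + x))"
    by (rule continuous_within_compose3) (intro continuous_intros)
  have "isCont k (a + x)"
    using assms S by (auto simp: jumps_def)
  then have 2: "continuous (at x within A) (\<lambda>x. k (a + x))"
    by (rule continuous_within_compose3) (intro continuous_intros)
  show ?thesis
    unfolding bellman_integrand_def
    by (intro continuous_intros continuous_price_primitive_compose 1 2)
qed

lemma bellman_integrand_integrable: "bellman_integrand a integrable_on {0..b}"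
proof -
  obtain K where K: "\<And>t. \<bar>k t\<bar> \<le> K"
    using bounded_value by (auto simp: bounded_iff)
  have "compact (y ` {a..a + b})"
    using y_cont by (intro compact_continuous_image) (auto intro: continuous_on_subset)
  then obtain B where B: "\<And>t. t \<in> {a..a + b} \<Longrightarrow> \<bar>y t\<bar> \<le> B"
    by (meson compact_imp_bounded bounded_real imageI)
  have "\<bar>bellman_integrand a x\<bar> \<le> \<mu> * 1 * (2 * B + K + y 0)" if x: "x \<in> {0..b}" for x
  proof -
    define u where "u = y (a + x) + price_primitive q (k (a + x) + y 0 - y (a + x))"
    have "price_primitive q (k (a + x) + y 0 - y (a + x)) \<le> \<bar>k (a + x)\<bar> + y 0 + \<bar>y (a + x)\<bar>"
      using price_primitive_le_abs[of "k (a + x) + y 0 - y (a + x)"] y_nonneg[of 0] by linarith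
    then have "u \<le> 2 * B + K + y 0"
      using B[of "a + x"] K[of "a + x"] x by (simp add: u_def)
    moreover have "- (\<mu> + \<gamma>) * x \<le> 0"
      using intensity_pos discount_pos x by (intro mult_nonpos_nonneg) auto
    then have "exp (- (\<mu> + \<gamma>) * x) \<le> 1"
      by (simp only: exp_le_one_iff)
    moreover have "0 \<le> u"
      unfolding u_def by (intro add_nonneg_nonneg y_nonneg price_primitive_nonneg)
    ultimately have "\<mu> * exp (- (\<mu> + \<gamma>) * x) * u \<le> \<mu> * 1 * (2 * B + K + y 0)"
      using intensity_pos by (intro mult_mono mult_nonneg_nonneg) auto
    then show ?thesis
      using bellman_integrand_nonneg[of a x] by (simp add: bellman_integrand_def u_def)
  qed
  then show ?thesis
    by (intro integrable_on_interval_if_bounded measurable_bellman_integrand)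
qed

lemma discounted_continuous: "continuous_on A (discounted a)"
  unfolding discounted_def by (intro continuous_intros continuous_on_compose2[OF y_cont]) auto

text \<open>The bridge from the Cauchy problem to the Bellman equation: the terms with
  \<open>price_primitive\<close> in the integrand and in \<open>Phi\<close> cancel, and what remains
  is \<open>(\<mu> + \<gamma>) * y - D\<close>, discounted. The sign of \<open>Phi - D\<close> thus
  decides between sub- and supersolution.\<close>

lemma discounted_derivative:
  assumes "0 \<le> a" "0 \<le> x" "a + x \<notin> S"
  shows "(discounted a has_real_derivative
    (bellman_integrand a x + exp (- (\<mu> + \<gamma>) * x) * (Phi q k \<mu> \<gamma> (a + x) (y (a + x)) (y 0) - D (a + x))))
    (at x within {0..})"
proof -
  have "(y has_real_derivative D (a + x)) (at (a + x) within (\<lambda>x. a + x) ` {0..})"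
    using y_deriv[of "a + x"] assms by (auto intro: has_field_derivative_subset)
  then have "((y \<circ> (\<lambda>x. a + x)) has_real_derivative D (a + x) * 1) (at x within {0..})"
    by (rule DERIV_image_chain) (auto intro!: derivative_eq_intros)
  then have 1: "((\<lambda>x. y (a + x)) has_real_derivative D (a + x)) (at x within {0..})"
    by (simp add: comp_def)
  show ?thesis
    unfolding discounted_def
    by (rule derivative_eq_intros 1 refl)+ (simp add: bellman_integrand_def Phi_def algebra_simps)
qed

lemma countable_shifted_exceptions: "countable ((\<lambda>s. s - a) ` S)"
  using S by simp

lemma shifted_exceptions: "x \<notin> (\<lambda>s. s - a) ` S \<longleftrightarrow> a + x \<notin> S"
  by (force simp: image_iff algebra_simps)

text \<open>Integrating over \<open>{0..n}\<close> gives at most \<open>y a\<close> minus a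
  discounted boundary term; the latter is non-negative because \<open>y\<close> is.\<close>

lemma bellman_supersolution:
  assumes D: "\<And>t. 0 \<le> t \<Longrightarrow> t \<notin> S \<Longrightarrow> D t \<le> Phi q k \<mu> \<gamma> t (y t) (y 0)" and "0 \<le> a"
  shows "bellman y a \<le> ennreal (y a)"
  unfolding bellman_eq_integrand
proof (rule nn_integral_atLeast_le)
  fix n :: nat
  have "integral {0..real n} (bellman_integrand a) \<le> discounted a (real n) - discounted a 0"
  proof (rule integral_le_if_derivative_ge[OF bellman_integrand_integrable _ countable_shifted_exceptions])
    fix x assume x: "0 \<le> x" "x \<notin> (\<lambda>s. s - a) ` S"
    then have "a + x \<notin> S"
      by (simp only: shifted_exceptions not_False_eq_True)
    then show "continuous (at x within {0..}) (bellman_integrand a)"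
      by (rule continuous_bellman_integrand)
    have "0 \<le> exp (- (\<mu> + \<gamma>) * x) * (Phi q k \<mu> \<gamma> (a + x) (y (a + x)) (y 0) - D (a + x))"
      using D[of "a + x"] \<open>a + x \<notin> S\<close> \<open>0 \<le> a\<close> x(1) by (intro mult_nonneg_nonneg) auto
    then show "\<exists>D\<ge>bellman_integrand a x. (discounted a has_real_derivative D) (at x within {0..})"
      using discounted_derivative[OF \<open>0 \<le> a\<close> x(1) \<open>a + x \<notin> S\<close>] by (intro exI conjI) auto
  qed (auto intro: discounted_continuous)
  also have "\<dots> \<le> y a"
    by (simp add: discounted_def y_nonneg)
  finally show "(\<integral>\<^sup>+x. ennreal (bellman_integrand a x) * indicator {0..real n} x \<partial>lborel) \<le> ennreal (y a)"
    using bellman_integrand_nonneg bellman_integrand_integrable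
    by (simp add: nn_integral_interval_eq_integral ennreal_leI)
qed measurable

text \<open>Here the boundary term at \<open>n\<close> has the wrong sign, but it is at most
  \<open>exp (- (\<mu> + \<gamma>) * n) * B\<close> and vanishes in the limit.\<close>

lemma bellman_subsolution:
  assumes D: "\<And>t. 0 \<le> t \<Longrightarrow> t \<notin> S \<Longrightarrow> Phi q k \<mu> \<gamma> t (y t) (y 0) \<le> D t"
    and B: "\<And>t. y t \<le> B" and "0 \<le> a"
  shows "ennreal (y a) \<le> bellman y a"
proof (rule LIMSEQ_le_const2)
  have "(\<lambda>n. exp (- (\<mu> + \<gamma>)) ^ n * B) \<longlonglongrightarrow> 0 * B"
    using intensity_pos discount_pos by (intro tendsto_intros LIMSEQ_power_zero) auto
  then have "(\<lambda>n. y a - exp (- (\<mu> + \<gamma>) * real n) * B) \<longlonglongrightarrow> y a - 0 * B"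
    by (intro tendsto_diff tendsto_const) (simp add: exp_of_nat_mult[symmetric] mult.commute)
  then show "(\<lambda>n. ennreal (y a - exp (- (\<mu> + \<gamma>) * real n) * B)) \<longlonglongrightarrow> ennreal (y a)"
    by (intro tendsto_ennrealI) simp
  have "ennreal (y a - exp (- (\<mu> + \<gamma>) * real n) * B) \<le> bellman y a" for n
  proof -
    have "integral {0..real n} (\<lambda>x. - bellman_integrand a x) \<le> - discounted a (real n) - (- discounted a 0)"
    proof (rule integral_le_if_derivative_ge[OF _ _ countable_shifted_exceptions])
      fix x assume x: "0 \<le> x" "x \<notin> (\<lambda>s. s - a) ` S"
      then have "a + x \<notin> S"
        by (simp only: shifted_exceptions not_False_eq_True)
      then show "continuous (at x within {0..}) (\<lambda>x. - bellman_integrand a x)"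
        by (intro continuous_minus continuous_bellman_integrand)
      have "exp (- (\<mu> + \<gamma>) * x) * (Phi q k \<mu> \<gamma> (a + x) (y (a + x)) (y 0) - D (a + x)) \<le> 0"
        using D[of "a + x"] \<open>a + x \<notin> S\<close> \<open>0 \<le> a\<close> x(1) by (intro mult_nonneg_nonpos) auto
      then show "\<exists>D\<ge>- bellman_integrand a x. ((\<lambda>x. - discounted a x) has_real_derivative D) (at x within {0..})"
        using DERIV_minus[OF discounted_derivative[OF \<open>0 \<le> a\<close> x(1) \<open>a + x \<notin> S\<close>]]
        by (intro exI conjI) auto
    qed (auto intro!: integrable_neg bellman_integrand_integrable continuous_on_minus discounted_continuous)
    then have "discounted a (real n) - discounted a 0 \<le> integral {0..real n} (bellman_integrand a)"
      by simp
    moreover have "exp (- (\<mu> + \<gamma>) * real n) * y (a + real n) \<le> exp (- (\<mu> + \<gamma>) * real n) * B"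
      by (intro mult_left_mono B) simp
    moreover have "discounted a 0 = - y a"
      by (simp add: discounted_def)
    ultimately have "y a - exp (- (\<mu> + \<gamma>) * real n) * B \<le> integral {0..real n} (bellman_integrand a)"
      unfolding discounted_def[of a "real n"] by linarith
    then have "ennreal (y a - exp (- (\<mu> + \<gamma>) * real n) * B) \<le>
        (\<integral>\<^sup>+x. ennreal (bellman_integrand a x) * indicator {0..real n} x \<partial>lborel)"
      using bellman_integrand_nonneg bellman_integrand_integrable
      by (simp add: nn_integral_interval_eq_integral ennreal_leI)
    also have "\<dots> \<le> bellman y a"
      unfolding bellman_eq_integrand by (intro nn_integral_mono) (auto simp: indicator_def)
    finally show ?thesis .
  qed
  then show "\<exists>N. \<forall>n\<ge>N. ennreal (y a - exp (- (\<mu> + \<gamma>) * real n) * B) \<le> bellman y a"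
    by blast
qed

end

section \<open>Upper and lower bounds on the optimal value\<close>

lemma optimal_value_le_if_diverges:
  assumes "0 \<le> c" and div: "diverges_to_infinity (Z q k \<mu> \<gamma> c c)"
  shows "optimal_value M X C k \<gamma> 0 \<le> ereal c"
proof -
  obtain Y where Y: "Y 0 = c" "continuous_on {0..} Y"
    "\<And>t. 0 \<le> t \<Longrightarrow> t \<notin> jumps \<Longrightarrow> (Y has_real_derivative Phi q k \<mu> \<gamma> t (Y t) c) (at t within {0..})"
    using global_solution[of c c] by blast
  define J where "J = {t. 0 \<le> t \<and> (\<forall>s\<in>{0..t}. 0 \<le> Y s)}"
  have "Z q k \<mu> \<gamma> c c = (J, restrict Y J)"
    unfolding J_def by (rule Z_eq[OF \<open>0 \<le> c\<close> Y])
  then have "J = {0..}"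
    using div by (simp add: diverges_to_infinity_def)
  have nonneg: "0 \<le> Y t" if "0 \<le> t" for t
  proof -
    have "t \<in> J"
      using that \<open>J = {0..}\<close> by simp
    then show ?thesis
      by (simp add: J_def)
  qed
  \<comment> \<open>Extended constantly to negative times, since continuity and non-negativity are
    required on the whole line.\<close>
  define y where "y t = Y (max 0 t)" for t
  have y_cont: "continuous_on UNIV y"
    unfolding y_def by (rule continuous_on_compose2[OF Y(2)]) (auto intro!: continuous_intros)
  have y_nonneg: "0 \<le> y t" for t
    by (simp add: y_def nonneg)
  have y_deriv: "(y has_real_derivative Phi q k \<mu> \<gamma> t (y t) (y 0)) (at t within {0..})"
    if "0 \<le> t" "t \<notin> jumps" for t
  proof -
    have "(y has_real_derivative Phi q k \<mu> \<gamma> t (Y t) c) (at t within {0..})"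
      by (rule has_field_derivative_transform_within[OF Y(3)[OF that], where d=1])
         (use that in \<open>auto simp: y_def\<close>)
    then show ?thesis
      using that by (simp add: y_def Y(1))
  qed
  have super: "bellman y a \<le> ennreal (y a)" if "0 \<le> a" for a
    by (rule bellman_supersolution[OF y_cont y_nonneg countable_jumps order_refl y_deriv order_refl that])
  have "policy_value M X C k \<gamma> \<beta> 0 \<le> ereal (y 0)" if "\<beta> \<in> policies" for \<beta>
    using that super y_nonneg borel_measurable_continuous_onI[OF y_cont]
    by (intro policy_value_le_supersolution) (auto simp: policies_def)
  then show ?thesis
    unfolding optimal_value_def by (intro SUP_least) (simp add: y_def Y(1))
qed

lemma optimal_value_ge_subsolution:
  assumes y_cont: "continuous_on UNIV y" and y_nonneg: "\<And>t. 0 \<le> y t" and y_le: "\<And>t. y t \<le> B"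
    and S: "countable S" "jumps \<subseteq> S"
    and y_deriv: "\<And>t. 0 \<le> t \<Longrightarrow> t \<notin> S \<Longrightarrow> (y has_real_derivative D t) (at t within {0..})"
    and D: "\<And>t. 0 \<le> t \<Longrightarrow> t \<notin> S \<Longrightarrow> Phi q k \<mu> \<gamma> t (y t) (y 0) \<le> D t"
  shows "ereal (y 0) \<le> optimal_value M X C k \<gamma> 0"
proof -
  have [measurable]: "y \<in> borel_measurable borel"
    by (rule borel_measurable_continuous_onI[OF y_cont])
  have sub: "ennreal (y a) \<le> bellman y a" if "0 \<le> a" for a
    by (rule bellman_subsolution[OF y_cont y_nonneg S y_deriv D y_le that])
  have "ereal (y 0) \<le> policy_value M X C k \<gamma> (greedy_policy y) 0"
    by (rule policy_value_ge_subsolution[OF _ y_nonneg y_le order_refl sub]) measurable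
  also have "greedy_policy y \<in> policies"
    unfolding policies_def greedy_policy_def[abs_def] by auto
  then have "policy_value M X C k \<gamma> (greedy_policy y) 0 \<le> optimal_value M X C k \<gamma> 0"
    unfolding optimal_value_def by (rule SUP_upper)
  finally show ?thesis .
qed

text \<open>The value 0 may be kept from the first zero on because \<open>Phi\<close> is
  non-positive at \<open>y = 0\<close>, so the derivative 0 of the constant is large enough for a
  subsolution.\<close>

lemma optimal_value_ge_if_hits_zero:
  assumes "0 \<le> c" and Y: "Y 0 = c" "continuous_on {0..} Y"
    "\<And>t. 0 \<le> t \<Longrightarrow> t \<notin> jumps \<Longrightarrow> (Y has_real_derivative Phi q k \<mu> \<gamma> t (Y t) c) (at t within {0..})"
    and t0: "0 \<le> t0" "Y t0 \<le> 0"
  shows "ereal c \<le> optimal_value M X C k \<gamma> 0"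
proof -
  define A where "A = {0..t0} \<inter> Y -` {..0}"
  have Y_cont: "continuous_on {0..t} Y" for t
    using Y(2) by (rule continuous_on_subset) auto
  have "closed A"
    unfolding A_def by (intro continuous_closed_preimage Y_cont) auto
  then have "compact A"
    using compact_Int_closed[of "{0..t0}" A] by (simp add: A_def Int_absorb1)
  moreover have "t0 \<in> A"
    using t0 by (simp add: A_def)
  ultimately obtain T where T: "T \<in> A" "\<And>t. t \<in> A \<Longrightarrow> T \<le> t"
    using compact_attains_inf[of A] by blast
  then have "0 \<le> T" "T \<le> t0" "Y T \<le> 0"
    by (auto simp: A_def)
  have "\<exists>z\<ge>0. z \<le> T \<and> Y z = 0"
    using \<open>0 \<le> T\<close> \<open>Y T \<le> 0\<close> Y(1) \<open>0 \<le> c\<close> Y_cont by (intro IVT2') auto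
  then obtain z where z: "0 \<le> z" "z \<le> T" "Y z = 0"
    by blast
  then have "z \<in> A"
    using \<open>T \<le> t0\<close> by (simp add: A_def)
  then have "Y T = 0"
    using T(2)[of z] z by simp
  have before: "0 \<le> Y s" if "0 \<le> s" "s \<le> T" for s
  proof (rule ccontr)
    assume "\<not> 0 \<le> Y s"
    then have "s \<in> A"
      using that \<open>T \<le> t0\<close> by (simp add: A_def)
    then have "s = T"
      using T(2)[of s] that by simp
    then show False
      using \<open>Y T = 0\<close> \<open>\<not> 0 \<le> Y s\<close> by simp
  qed
  have "compact (Y ` {0..T})"
    by (intro compact_continuous_image Y_cont) simp
  then obtain B where B: "\<And>s. s \<in> {0..T} \<Longrightarrow> \<bar>Y s\<bar> \<le> B"
    by (meson compact_imp_bounded bounded_real imageI)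
  \<comment> \<open>Freezing time at the first zero \<open>T\<close> continues the solution by 0;
    compactness of \<open>{0..T}\<close> bounds it.\<close>
  define y where "y s = Y (max 0 (min s T))" for s
  define D where "D s = (if s < T then Phi q k \<mu> \<gamma> s (Y s) c else 0)" for s
  have y0: "y 0 = c"
    using \<open>0 \<le> T\<close> Y(1) by (simp add: y_def)
  have "ereal (y 0) \<le> optimal_value M X C k \<gamma> 0"
  \<comment> \<open>The path may have a kink at \<open>T\<close>, which therefore joins the jumps in
    the exceptional set.\<close>
  proof (rule optimal_value_ge_subsolution[where S="insert T jumps" and D=D and B=B])
    show "continuous_on UNIV y"
      unfolding y_def by (rule continuous_on_compose2[OF Y(2)]) (auto intro!: continuous_intros)
    show "0 \<le> y s" for s
      using \<open>0 \<le> T\<close> by (auto simp: y_def intro!: before)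
    show "y s \<le> B" for s
      using B[of "max 0 (min s T)"] \<open>0 \<le> T\<close> by (auto simp: y_def)
    fix s assume s: "0 \<le> s" "s \<notin> insert T jumps"
    show "Phi q k \<mu> \<gamma> s (y s) (y 0) \<le> D s"
    proof (cases "s < T")
      case True
      then show ?thesis
        using s by (simp add: y0) (simp add: y_def D_def)
    next
      case False
      then have "y s = 0"
        using \<open>Y T = 0\<close> \<open>0 \<le> T\<close> by (simp add: y_def)
      then show ?thesis
        using False intensity_pos price_primitive_nonneg by (simp add: D_def Phi_def)
    qed
    show "(y has_real_derivative D s) (at s within {0..})"
    proof (cases "s < T")
      case True
      have "(Y has_real_derivative D s) (at s within {0..})"
        using Y(3)[of s] s True by (simp add: D_def)
      then show ?thesis
        by (rule has_field_derivative_transform_within[where d="T - s"])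
           (use s True in \<open>auto simp: y_def dist_real_def\<close>)
    next
      case False
      have "((\<lambda>_. 0) has_real_derivative D s) (at s within {0..})"
        using False by (simp add: D_def)
      then show ?thesis
        by (rule has_field_derivative_transform_within[where d="s - T"])
           (use s False \<open>Y T = 0\<close> \<open>0 \<le> T\<close> in \<open>auto simp: y_def dist_real_def max_def min_def\<close>)
    qed
  qed (use countable_jumps in auto)
  then show ?thesis
    by (simp add: y0)
qed

text \<open>
  Above the level \<open>K + c\<close> no auction is worth winning, so the solution follows \<open>Y' = \<gamma> Y\<close> for ever.
\<close>

lemma solution_unbounded_imp_at_top:
  assumes "0 \<le> c" and K: "\<And>t. \<bar>k t\<bar> \<le> K" and Y: "continuous_on {0..} Y"
    "\<And>t. 0 \<le> t \<Longrightarrow> t \<notin> jumps \<Longrightarrow> (Y has_real_derivative Phi q k \<mu> \<gamma> t (Y t) c) (at t within {0..})"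
    and t0: "0 \<le> t0" "K + c < Y t0"
  shows "filterlim Y at_top at_top"
proof -
  have "0 \<le> K"
    using K[of 0] by simp
  then have "0 < Y t0"
    using t0 \<open>0 \<le> c\<close> by simp
  have Phi_eq: "Phi q k \<mu> \<gamma> t (Y t) c = \<gamma> * Y t" if "K + c \<le> Y t" for t
    using that K[of t] by (simp add: Phi_def price_primitive_nonpos)
  have deriv: "(Y has_real_derivative \<gamma> * Y s) (at s within {t0..t})"
    if "s \<in> {t0..t}" "s \<notin> jumps" "K + c \<le> Y s" for s t
  proof -
    have "(Y has_real_derivative \<gamma> * Y s) (at s within {0..})"
      using Y(2)[of s] Phi_eq[OF that(3)] that t0(1) by auto
    then show ?thesis
      by (rule has_field_derivative_subset) (use t0(1) in auto)
  qed
  have cont: "continuous_on {t0..t} Y" for t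
    using Y(1) by (rule continuous_on_subset) (use t0(1) in auto)
  \<comment> \<open>The level cannot be crossed downwards: up to the first time \<open>T\<close> at
    which \<open>Y\<close> has come down to \<open>K + c\<close>, its derivative is non-negative, so
    \<open>Y T\<close> is at least \<open>Y t0\<close>.\<close>
  have above: "K + c < Y t" if "t0 \<le> t" for t
  proof (rule ccontr)
    assume "\<not> K + c < Y t"
    define A where "A = {t0..t} \<inter> Y -` {..K + c}"
    have "closed A"
      unfolding A_def by (intro continuous_closed_preimage cont) auto
    then have "compact A"
      using compact_Int_closed[of "{t0..t}" A] by (simp add: A_def Int_absorb1)
    moreover have "t \<in> A"
      using that \<open>\<not> K + c < Y t\<close> by (simp add: A_def)
    ultimately obtain T where T: "T \<in> A" "\<And>s. s \<in> A \<Longrightarrow> T \<le> s"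
      using compact_attains_inf[of A] by blast
    then have "t0 \<le> T" "T \<le> t" "Y T \<le> K + c"
      by (auto simp: A_def)
    have before: "K + c < Y s" if "t0 \<le> s" "s < T" for s
      using T(2)[of s] that \<open>T \<le> t\<close> by (force simp: A_def)
    have "Y t0 \<le> Y T"
    proof (rule nondecreasing_if_derivative_nonneg_off_countable[OF \<open>t0 \<le> T\<close> cont, where S="insert T jumps"])
      fix s assume s: "s \<in> {t0..T} - insert T jumps"
      then have "K + c < Y s"
        by (intro before) auto
      moreover from this have "0 \<le> \<gamma> * Y s"
        using \<open>0 \<le> K\<close> \<open>0 \<le> c\<close> discount_pos by simp
      ultimately show "\<exists>D\<ge>0. (Y has_real_derivative D) (at s within {t0..T})"
        using deriv[of s T] s by auto
    qed (use countable_jumps in auto)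
    then show False
      using \<open>Y T \<le> K + c\<close> t0(2) by simp
  qed
  have mono: "Y t0 \<le> Y t" if "t0 \<le> t" for t
  proof (rule nondecreasing_if_derivative_nonneg_off_countable[OF that cont countable_jumps])
    fix s assume s: "s \<in> {t0..t} - jumps"
    have "0 \<le> \<gamma> * Y s"
      using above[of s] s \<open>0 \<le> K\<close> \<open>0 \<le> c\<close> discount_pos by simp
    then show "\<exists>D\<ge>0. (Y has_real_derivative D) (at s within {t0..t})"
      using deriv[of s t] above[of s] s by auto
  qed
  \<comment> \<open>The growth is exponential, but replacing \<open>Y s\<close> by its lower bound
    \<open>Y t0\<close> in the derivative gives a linear bound, which suffices for
    divergence.\<close>
  have linear: "Y t0 + \<gamma> * Y t0 * (t - t0) \<le> Y t" if "t0 \<le> t" for t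
  proof -
    have "Y t0 - \<gamma> * Y t0 * t0 \<le> Y t - \<gamma> * Y t0 * t"
    proof (rule nondecreasing_if_derivative_nonneg_off_countable[OF that _ countable_jumps])
      show "continuous_on {t0..t} (\<lambda>s. Y s - \<gamma> * Y t0 * s)"
        by (intro continuous_intros cont)
      fix s assume s: "s \<in> {t0..t} - jumps"
      then have "(Y has_real_derivative \<gamma> * Y s) (at s within {t0..t})"
        using deriv[of s t] above[of s] by auto
      then have "((\<lambda>s. Y s - \<gamma> * Y t0 * s) has_real_derivative \<gamma> * Y s - \<gamma> * Y t0) (at s within {t0..t})"
        by (auto intro!: derivative_eq_intros)
      moreover have "0 \<le> \<gamma> * Y s - \<gamma> * Y t0"
        using mono[of s] s discount_pos by simp
      ultimately show "\<exists>D\<ge>0. ((\<lambda>s. Y s - \<gamma> * Y t0 * s) has_real_derivative D) (at s within {t0..t})"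
        by blast
    qed
    then show ?thesis
      by (simp add: algebra_simps)
  qed
  show ?thesis
    unfolding filterlim_at_top
  proof
    fix r
    define g where "g = \<gamma> * Y t0"
    have "0 < g"
      using discount_pos \<open>0 < Y t0\<close> by (simp add: g_def)
    have "r \<le> Y t" if t: "max t0 (t0 + r / g) \<le> t" for t
    proof -
      have "r \<le> g * (t - t0)"
        using t \<open>0 < g\<close> by (simp add: field_simps)
      also have "\<dots> \<le> Y t"
        using linear[of t] t \<open>0 < Y t0\<close> by (simp add: g_def)
      finally show ?thesis .
    qed
    then show "\<forall>\<^sub>F t in at_top. r \<le> Y t"
      unfolding eventually_at_top_linorder by blast
  qed
qed

lemma optimal_value_ge_if_not_diverges:
  assumes "0 \<le> c" and div: "\<not> diverges_to_infinity (Z q k \<mu> \<gamma> c c)"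
  shows "ereal c \<le> optimal_value M X C k \<gamma> 0"
proof -
  obtain Y where Y: "Y 0 = c" "continuous_on {0..} Y"
    "\<And>t. 0 \<le> t \<Longrightarrow> t \<notin> jumps \<Longrightarrow> (Y has_real_derivative Phi q k \<mu> \<gamma> t (Y t) c) (at t within {0..})"
    using global_solution[of c c] by blast
  show ?thesis
  proof (cases "\<exists>t\<ge>0. Y t < 0")
    case True
    then obtain t where t: "0 \<le> t" "Y t \<le> 0"
      by force
    show ?thesis
      by (rule optimal_value_ge_if_hits_zero[OF \<open>0 \<le> c\<close> Y t])
  next
    case False
    then have nonneg: "0 \<le> Y t" if "0 \<le> t" for t
      using that by (auto simp: not_less)
    have "Z q k \<mu> \<gamma> c c =
        ({t. 0 \<le> t \<and> (\<forall>s\<in>{0..t}. 0 \<le> Y s)}, restrict Y {t. 0 \<le> t \<and> (\<forall>s\<in>{0..t}. 0 \<le> Y s)})"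
      by (rule Z_eq[OF \<open>0 \<le> c\<close> Y])
    also have "{t. 0 \<le> t \<and> (\<forall>s\<in>{0..t}. 0 \<le> Y s)} = {0..}"
      using nonneg by auto
    finally have Z: "Z q k \<mu> \<gamma> c c = ({0..}, restrict Y {0..})" .
    have "filterlim (restrict Y {0..}) at_top at_top \<longleftrightarrow> filterlim Y at_top at_top"
      by (intro filterlim_cong refl eventually_mono[OF eventually_ge_at_top[of 0]]) simp
    then have "\<not> filterlim Y at_top at_top"
      using div by (simp add: Z diverges_to_infinity_def)
    obtain K where K: "\<And>t. \<bar>k t\<bar> \<le> K"
      using bounded_value by (auto simp: bounded_iff)
    \<comment> \<open>A single crossing of the level above which no auction is worth winning would
      force divergence; hence this explicit bound for the subsolution.\<close>
    have bound: "Y t \<le> K + c" if "0 \<le> t" for t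
    proof (rule ccontr)
      assume "\<not> Y t \<le> K + c"
      then have "K + c < Y t"
        by simp
      have "filterlim Y at_top at_top"
        by (rule solution_unbounded_imp_at_top[OF \<open>0 \<le> c\<close> K Y(2,3) that \<open>K + c < Y t\<close>])
      with \<open>\<not> filterlim Y at_top at_top\<close> show False
        by simp
    qed
    define y where "y t = Y (max 0 t)" for t
    have y0: "y 0 = c"
      by (simp add: y_def Y(1))
    have "ereal (y 0) \<le> optimal_value M X C k \<gamma> 0"
    proof (rule optimal_value_ge_subsolution[where S=jumps and D="\<lambda>t. Phi q k \<mu> \<gamma> t (Y t) c" and B="K + c"])
      show "continuous_on UNIV y"
        unfolding y_def by (rule continuous_on_compose2[OF Y(2)]) (auto intro!: continuous_intros)
      fix t assume t: "0 \<le> t" "t \<notin> jumps"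
      show "(y has_real_derivative Phi q k \<mu> \<gamma> t (Y t) c) (at t within {0..})"
        by (rule has_field_derivative_transform_within[OF Y(3)[OF t], where d=1])
           (use t in \<open>auto simp: y_def\<close>)
      show "Phi q k \<mu> \<gamma> t (y t) (y 0) \<le> Phi q k \<mu> \<gamma> t (Y t) c"
        unfolding y0 using t by (simp add: y_def)
    qed (use countable_jumps in \<open>auto simp: y_def nonneg bound\<close>)
    then show ?thesis
      by (simp add: y0)
  qed
qed

section \<open>Invariant and error of the bisection\<close>

lemma search_interval_invariant:
  assumes "0 \<le> a" and v: "optimal_value M X C k \<gamma> 0 = ereal v" "a \<le> v" "v \<le> b"
    and "search_interval q k \<mu> \<gamma> a b n = (l, u)"
  shows "0 \<le> l \<and> l \<le> v \<and> v \<le> u \<and> u - l = (b - a) / 2 ^ n"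
  using assms(5)
proof (induction n arbitrary: l u)
  case 0
  then show ?case
    using assms(1-4) by simp
next
  case (Suc n)
  obtain l' u' where prev: "search_interval q k \<mu> \<gamma> a b n = (l', u')"
    by fastforce
  define c where "c = (l' + u') / 2"
  note IH = Suc.IH[OF prev]
  \<comment> \<open>The invariant carries \<open>0 \<le> l\<close> so that every midpoint is an
    admissible initial value of the Cauchy problem.\<close>
  have "0 \<le> c"
    using IH by (simp add: c_def)
  have half: "c - l' = (u' - l') / 2" "u' - c = (u' - l') / 2"
    by (simp_all add: c_def field_simps)
  show ?case
  proof (cases "diverges_to_infinity (Z q k \<mu> \<gamma> c c)")
    case True
    then have "l = l'" "u = c"
      using Suc.prems by (simp_all add: prev Let_def c_def)
    then show ?thesis
      using IH optimal_value_le_if_diverges[OF \<open>0 \<le> c\<close> True] v(1)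
      by (simp add: half)
  next
    case False
    then have "l = c" "u = u'"
      using Suc.prems by (simp_all add: prev Let_def c_def)
    then show ?thesis
      using IH optimal_value_ge_if_not_diverges[OF \<open>0 \<le> c\<close> False] v(1) \<open>0 \<le> c\<close>
      by (simp add: half)
  qed
qed

text \<open>Every solution starts at the midpoint used as its initial value, so the iterate at time
  0 and \<open>v\<close> lie in the same search interval.\<close>

lemma iterate_error:
  assumes "0 \<le> a" and v: "optimal_value M X C k \<gamma> 0 = ereal v" "a \<le> v" "v \<le> b"
  shows "\<bar>v - iterate q k \<mu> \<gamma> a b n 0\<bar> \<le> (b - a) / 2 ^ n"
proof -
  obtain l u where lu: "search_interval q k \<mu> \<gamma> a b n = (l, u)"
    by fastforce
  note inv = search_interval_invariant[OF assms lu]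
  define c where "c = (l + u) / 2"
  have "0 \<le> c"
    using inv by (simp add: c_def)
  obtain Y where Y: "Y 0 = c" "continuous_on {0..} Y"
    "\<And>t. 0 \<le> t \<Longrightarrow> t \<notin> jumps \<Longrightarrow> (Y has_real_derivative Phi q k \<mu> \<gamma> t (Y t) c) (at t within {0..})"
    using global_solution[of c c] by blast
  have "iterate q k \<mu> \<gamma> a b n 0 = snd (Z q k \<mu> \<gamma> c c) 0"
    by (simp add: iterate_def lu Let_def c_def)
  also have "\<dots> = c"
    using \<open>0 \<le> c\<close> Y(1) by (subst Z_eq[OF \<open>0 \<le> c\<close> Y]) simp_all
  finally have "\<bar>v - iterate q k \<mu> \<gamma> a b n 0\<bar> = \<bar>v - c\<bar>"
    by simp
  also have "\<dots> \<le> u - l"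
  proof -
    have "\<bar>v - (l + u) / 2\<bar> \<le> u - l" if "l \<le> v" "v \<le> u"
      using that by (simp add: abs_le_iff field_simps)
    then show ?thesis
      using inv by (simp add: c_def)
  qed
  finally show ?thesis
    using inv by simp
qed

end

section \<open>Values at negative ages\<close>

context auction_model
begin

text \<open>Keeps the value at age 0 for negative arguments, which makes it monotone and bounded on
  the line. From a non-negative initial age all ages are almost surely non-negative, and solutions
  run over non-negative times, so policy values and iterates are unchanged.\<close>

abbreviation nonneg_value :: "real \<Rightarrow> real" where "nonneg_value t \<equiv> k (max 0 t)"

lemma monotone_auction_model_nonneg_value: "monotone_auction_model M X C q nonneg_value \<mu> \<gamma>"
proof -
  have "range nonneg_value \<subseteq> k ` {0..}"
    by auto
  then have bounded: "bounded (range nonneg_value)"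
    using value_bounded bounded_subset by blast
  have mono: "mono nonneg_value"
    using value_mono by (auto intro!: monoI simp: mono_on_def)
  have "auction_model M X C q nonneg_value \<mu> \<gamma>"
  proof
    show "mono_on {0..} nonneg_value"
      using mono by (rule mono_imp_mono_on)
    show "bounded (nonneg_value ` {0..})"
      using bounded by (rule bounded_subset) (rule image_mono, simp)
  qed (fact intensity_pos discount_pos interarrival price_cdf price_nonneg indep)+
  then show ?thesis
    by (intro monotone_auction_model.intro monotone_auction_model_axioms.intro mono bounded)
qed

lemma policy_value_nonneg_value:
  assumes "0 \<le> \<tau>"
  shows "policy_value M X C nonneg_value \<gamma> \<beta> \<tau> = policy_value M X C k \<gamma> \<beta> \<tau>"
proof -
  have "AE \<omega> in M. \<forall>n. payoff X C nonneg_value \<gamma> \<beta> \<tau> n \<omega> = payoff X C k \<gamma> \<beta> \<tau> n \<omega>"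
    using AE_history_nonneg[OF assms, of \<beta>] by eventually_elim (simp add: payoff_def)
  then have "(\<integral>\<^sup>+\<omega>. (\<Sum>i. ennreal (payoff X C nonneg_value \<gamma> \<beta> \<tau> i \<omega>)) \<partial>M) =
      (\<integral>\<^sup>+\<omega>. (\<Sum>i. ennreal (payoff X C k \<gamma> \<beta> \<tau> i \<omega>)) \<partial>M)"
    "(\<integral>\<^sup>+\<omega>. (\<Sum>i. ennreal (- payoff X C nonneg_value \<gamma> \<beta> \<tau> i \<omega>)) \<partial>M) =
      (\<integral>\<^sup>+\<omega>. (\<Sum>i. ennreal (- payoff X C k \<gamma> \<beta> \<tau> i \<omega>)) \<partial>M)"
    by (auto intro!: nn_integral_cong_AE elim!: eventually_mono)
  then show ?thesis
    by (simp add: policy_value_def)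
qed

lemma Z_nonneg_value: "Z q nonneg_value \<mu> \<gamma> y0 l = Z q k \<mu> \<gamma> y0 l"
proof -
  have "maximal_solution (\<lambda>t y. Phi q nonneg_value \<mu> \<gamma> t y l) y0 J Y \<longleftrightarrow>
      maximal_solution (\<lambda>t y. Phi q k \<mu> \<gamma> t y l) y0 J Y" for J Y
    by (rule maximal_solution_cong) (simp add: Phi_def)
  then show ?thesis
    by (simp add: Z_def)
qed

lemma iterate_nonneg_value: "iterate q nonneg_value \<mu> \<gamma> a b n = iterate q k \<mu> \<gamma> a b n"
proof -
  have "search_interval q nonneg_value \<mu> \<gamma> a b n = search_interval q k \<mu> \<gamma> a b n"
    by (induction n) (simp_all add: Z_nonneg_value)
  then show ?thesis
    by (simp add: iterate_def Z_nonneg_value)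
qed

end

theorem theorem2:
  fixes M :: "'a measure"
    and X C :: "nat \<Rightarrow> 'a \<Rightarrow> real"
    and q k :: "real \<Rightarrow> real"
    and \<mu> \<gamma> a b :: real
  assumes "auction_model M X C q k \<mu> \<gamma>"
    and "continuous_on UNIV q"
    and "0 \<le> a" and "0 < b"
    and "optimal_value M X C k \<gamma> 0 \<in> {ereal a..ereal b}"
  shows "(\<lambda>n. norm (real_of_ereal (optimal_value M X C k \<gamma> 0) - iterate q k \<mu> \<gamma> a b n 0))
           \<in> O(\<lambda>n. 1 / 2 ^ n)"
proof -
  interpret auction_model M X C q k \<mu> \<gamma>
    by (rule assms(1))
  interpret mono: monotone_auction_model M X C q nonneg_value \<mu> \<gamma>
    by (rule monotone_auction_model_nonneg_value)
  have eq: "optimal_value M X C nonneg_value \<gamma> 0 = optimal_value M X C k \<gamma> 0"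
    by (simp add: optimal_value_def policy_value_nonneg_value)
  \<comment> \<open>Lying between two real bounds, the optimal value is finite, so
    \<open>real_of_ereal\<close> returns it faithfully.\<close>
  obtain v where v: "optimal_value M X C k \<gamma> 0 = ereal v" "a \<le> v" "v \<le> b"
    using assms(5) by (cases "optimal_value M X C k \<gamma> 0") auto
  have "\<bar>v - iterate q k \<mu> \<gamma> a b n 0\<bar> \<le> (b - a) / 2 ^ n" for n
    using mono.iterate_error[OF \<open>0 \<le> a\<close> _ v(2,3), of n] by (simp add: eq v(1) iterate_nonneg_value)
  then show ?thesis
    by (intro bigoI[where c="b - a"]) (auto simp: v(1))
qed

end
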